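(* For all integers $n\ge 4$ with $n\neq 6$, $$\operatorname{ex}_{\mathcal P}(n,C_5,\{C_4\})=n-4.$$
   Context: All graphs are finite and simple. $C_t$ denotes the cycle on $t$ vertices. $\operatorname{ex}_{\mathcal P}(n,H,\{F\})$ denotes the maximum number of copies of $H$ (subgraphs isomorphic to $H$, not necessarily induced) in an $n$-vertex planar graph that does not contain $F$ as a subgraph (not necessarily induced). *)

theory Defs
  imports "HOL-Analysis.Analysis"
begin

record 'a sgraph =
  verts :: "'a set"
  edges :: "'a set set"

definition simple_graph :: "'a sgraph \<Rightarrow> bool" where
  "simple_graph G \<longleftrightarrow> finite (verts G) \<and>
     (\<forall>e\<in>edges G. \<exists>u\<in>verts G. \<exists>v\<in>verts G. u \<noteq> v \<and> e = {u, v})"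

definition subgraph_of :: "'a sgraph \<Rightarrow> 'a sgraph \<Rightarrow> bool" where
  "subgraph_of K G \<longleftrightarrow> simple_graph K \<and> verts K \<subseteq> verts G \<and> edges K \<subseteq> edges G"

definition isomorphic :: "'a sgraph \<Rightarrow> 'b sgraph \<Rightarrow> bool" where
  "isomorphic H K \<longleftrightarrow>
     (\<exists>f. bij_betw f (verts H) (verts K) \<and> edges K = (\<lambda>e. f ` e) ` edges H)"

definition copies :: "'b sgraph \<Rightarrow> 'a sgraph \<Rightarrow> 'a sgraph set" where
  "copies H G = {K. subgraph_of K G \<and> isomorphic H K}"

definition free_of :: "'a sgraph \<Rightarrow> 'b sgraph \<Rightarrow> bool" where
  "free_of G F \<longleftrightarrow> \<not> (\<exists>K. subgraph_of K G \<and> isomorphic F K)"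

text \<open>A drawing in the plane (identified with the complex numbers): vertices are distinct
  points, every edge is a simple arc joining its two end vertices, and the remaining points of
  that arc lie neither on a vertex nor on another edge.\<close>

definition plane_drawing :: "'a sgraph \<Rightarrow> ('a \<Rightarrow> complex) \<Rightarrow> ('a set \<Rightarrow> real \<Rightarrow> complex) \<Rightarrow> bool" where
  "plane_drawing G p \<gamma> \<longleftrightarrow>
     inj_on p (verts G) \<and>
     (\<forall>e\<in>edges G. arc (\<gamma> e) \<and> {pathstart (\<gamma> e), pathfinish (\<gamma> e)} = p ` e) \<and>
     (\<forall>e\<in>edges G. (path_image (\<gamma> e) - p ` e) \<inter> p ` verts G = {}) \<and>
     (\<forall>e\<in>edges G. \<forall>e'\<in>edges G. e \<noteq> e' \<longrightarrow> (path_image (\<gamma> e) - p ` e) \<inter> path_image (\<gamma> e') = {})"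

definition planar :: "'a sgraph \<Rightarrow> bool" where
  "planar G \<longleftrightarrow> (\<exists>p \<gamma>. plane_drawing G p \<gamma>)"

text \<open>Intended for \<open>t \<ge> 3\<close>.\<close>

definition cycle_graph :: "nat \<Rightarrow> nat sgraph" where
  "cycle_graph t = \<lparr>verts = {..<t}, edges = {{i, (i + 1) mod t} | i. i < t}\<rparr>"

definition planar_free_graphs :: "nat \<Rightarrow> 'b sgraph set \<Rightarrow> nat sgraph set" where
  "planar_free_graphs n \<F> =
     {G. simple_graph G \<and> card (verts G) = n \<and> planar G \<and> (\<forall>F\<in>\<F>. free_of G F)}"

text \<open>Every graph on \<open>n\<close> vertices is isomorphic to one whose vertices are natural numbers, so it
  suffices to let these range over \<open>nat sgraph\<close>.  The maximum is over a finite set, see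
  \<open>finite_copy_counts\<close> below.\<close>

definition ex_planar :: "nat \<Rightarrow> 'c sgraph \<Rightarrow> 'b sgraph set \<Rightarrow> nat" where
  "ex_planar n H \<F> = Max {card (copies H G) | G. G \<in> planar_free_graphs n \<F>}"

lemma copies_bound:
  fixes G :: "'a sgraph"
  assumes "simple_graph G"
  shows "finite (copies H G)"
    and "card (copies H G) \<le> 2 ^ card (verts G) * 2 ^ (2 ^ card (verts G))"
proof -
  let ?V = "verts G"
  let ?P = "Pow ?V \<times> Pow (Pow ?V)"
  let ?f = "\<lambda>K :: 'a sgraph. (verts K, edges K)"
  have fin: "finite ?V" using assms by (simp add: simple_graph_def)
  then have finP: "finite ?P" by (intro finite_cartesian_product) (simp_all only: finite_Pow_iff)
  have inj: "inj_on ?f (copies H G)" by (rule inj_onI, rule sgraph.equality) simp_all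
  have sub: "?f ` copies H G \<subseteq> ?P"
  proof (rule image_subsetI)
    fix K assume "K \<in> copies H G"
    then have K: "simple_graph K" "verts K \<subseteq> ?V"
      by (simp_all add: copies_def subgraph_of_def)
    have "e \<subseteq> ?V" if e: "e \<in> edges K" for e
    proof -
      have "\<exists>u\<in>verts K. \<exists>v\<in>verts K. u \<noteq> v \<and> e = {u, v}"
        by (rule bspec[OF conjunct2[OF K(1)[unfolded simple_graph_def]] e])
      then obtain u v where "u \<in> verts K" "v \<in> verts K" and e: "e = {u, v}"
        by (elim bexE conjE)
      then have "u \<in> ?V" "v \<in> ?V" using K(2) by (simp_all only: subsetD)
      then show ?thesis unfolding e by simp
    qed
    then have "edges K \<subseteq> Pow ?V" by (rule subsetI[OF PowI])
    then show "?f K \<in> ?P" using K(2) by simp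
  qed
  show "finite (copies H G)" by (rule inj_on_finite[OF inj sub finP])
  have "card (copies H G) \<le> card ?P" by (rule card_inj_on_le[OF inj sub finP])
  also have "\<dots> = 2 ^ card ?V * 2 ^ (2 ^ card ?V)"
    using fin by (simp only: card_cartesian_product card_Pow finite_Pow_iff)
  finally show "card (copies H G) \<le> 2 ^ card ?V * 2 ^ (2 ^ card ?V)" .
qed

lemma finite_copy_counts:
  "finite {card (copies H G) | G. G \<in> planar_free_graphs n \<F>}" (is "finite ?S")
proof (rule finite_subset)
  show "?S \<subseteq> {..2 ^ n * 2 ^ (2 ^ n)}"
  proof
    fix x assume "x \<in> ?S"
    then obtain G :: "nat sgraph" where G: "simple_graph G" "card (verts G) = n" and x: "x = card (copies H G)"
      by (auto simp: planar_free_graphs_def)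
    show "x \<in> {..2 ^ n * 2 ^ (2 ^ n)}"
      using copies_bound(2)[OF G(1), of H] unfolding x G(2) by (rule iffD2[OF atMost_iff])
  qed
  show "finite {..2 ^ n * 2 ^ (2 ^ n) :: nat}" by (rule finite_atMost)
qed

end

theory Submission
  imports Defs
begin

text \<open>
  In a graph without four-cycles all five-cycles are induced, and in a plane drawing no two of them
  cross. Hence a five-cycle with vertices on both sides splits the graph into two smaller ones
  that share only this five-cycle, and the bound n - 4 follows by induction. If there is no such
  five-cycle, every five-cycle bounds a face. Consider the drawing of all edges on five-cycles: the
  Jordan curve theorem gives at least E - V + 2 faces, and by Janiszewski's theorem each edge
  is incident with at most two of them. Counting incidences, the number f of pentagonal faces
  satisfies 3 f + 4 \<le> 2 n, which is enough for n \<ge> 6.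

  Equality is attained by a path with two hubs that are joined alternately to pairs of consecutive
  vertices of the path and have one further common neighbour.
\<close>

section \<open>Faces of a system of arcs\<close>

text \<open>The shape n - 4 is what gluing preserves: parts with m and k vertices that share a
  five-cycle give n = m + k - 5, and the shared cycle is counted twice, so the bounds combine to (m
  - 4) + (k - 4) - 1 = n - 4 without loss. In the facial case let g be the number of faces
  considered and f the number of pentagonal ones. The incidences give 3 f + 2 g \<le> 2 E, Euler's
  inequality gives E + 2 \<le> g + V, and g cancels. Edges off the five-cycles are left out of the
  drawing because the bound of two faces per edge rests on a closed curve through the edge. For n =
  6 the bound n - 4 is not attained: two five-cycles on six vertices would share an induced path on
  four vertices, and each of the two remaining vertices would be adjacent to both of its ends, which
  gives a four-cycle.\<close>

definition oarc :: "(real \<Rightarrow> complex) \<Rightarrow> complex set" where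
  "oarc g = path_image g - {pathstart g, pathfinish g}"

lemma path_image_oarc: "path_image g = oarc g \<union> {pathstart g, pathfinish g}"
  by (auto simp: oarc_def)

lemma oarc_subset: "oarc g \<subseteq> path_image g"
  by (auto simp: oarc_def)

lemma connected_oarc: "arc g \<Longrightarrow> connected (oarc g)"
  unfolding oarc_def by (rule connected_simple_path_endless[OF arc_imp_simple_path])

lemma oarc_nonempty: "arc g \<Longrightarrow> oarc g \<noteq> {}"
  unfolding oarc_def by (rule nonempty_simple_path_endless[OF arc_imp_simple_path])

lemma path_image_subset_closure_oarc:
  assumes "arc g" shows "path_image g \<subseteq> closure (oarc g)"
proof -
  have "x \<in> closure (oarc g)" if "x \<in> {pathstart g, pathfinish g}" for x
  proof -
    have gs: "g ` ({0<..<1}) \<subseteq> oarc g"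
    proof -
      have "inj_on g {0..1}" using assms by (simp add: arc_def)
      then have "g t \<noteq> g 0 \<and> g t \<noteq> g 1" if "t \<in> {0<..<1}" for t
        using that inj_onD[of g "{0..1}" t 0] inj_onD[of g "{0..1}" t 1] by auto
      then show ?thesis by (auto simp: oarc_def pathstart_def pathfinish_def path_image_def)
    qed
    have "continuous_on {0..1} g" using assms by (simp add: arc_def path_def)
    then have "continuous_on (closure {0<..<1}) g" by simp
    then have "g ` closure {0<..<1} \<subseteq> closure (oarc g)"
      by (rule image_closure_subset) (use gs closure_subset in auto)
    then show ?thesis using that by (auto simp: pathstart_def pathfinish_def)
  qed
  then show ?thesis using closure_subset[of "oarc g"] path_image_oarc[of g] by auto
qed

text \<open>An arc is homeomorphic to an interval, so invariance of dimension applies. The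
  consequence used below is that no face is swallowed by an edge drawn into it.\<close>

lemma arc_image_not_open:
  assumes "arc (g :: real \<Rightarrow> complex)" "open D" "D \<noteq> {}"
  shows "\<not> D \<subseteq> path_image g"
proof
  assume sub: "D \<subseteq> path_image g"
  obtain h where h: "homeomorphism {0..1} (path_image g) g h"
    using assms(1) homeomorphism_arc by blast
  have "continuous_on D h"
    using h sub continuous_on_subset by (auto simp: homeomorphism_def)
  moreover have "inj_on h D"
    using h sub by (intro inj_on_inverseI[of _ g]) (auto simp: homeomorphism_def)
  ultimately have "DIM(complex) \<le> DIM(real)"
    using assms(2,3) invariance_of_dimension[of D h] by simp
  then show False by simp
qed

text \<open>The curve is split into an arc and a return arc because every closed curve below arises
  in this way: an edge together with an arc that avoids its interior.\<close>

lemma jordan_arc_pair: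
  assumes "arc (g :: real \<Rightarrow> complex)" "arc q" "pathstart q = pathfinish g" "pathfinish q = pathstart g"
    and "path_image q \<inter> oarc g = {}"
  defines "J \<equiv> path_image g \<union> path_image q"
  shows "inside J \<noteq> {}" "open (inside J)" "connected (inside J)"
    "outside J \<noteq> {}" "open (outside J)" "connected (outside J)"
    "inside J \<inter> outside J = {}" "inside J \<union> outside J = - J"
    "frontier (inside J) = J" "frontier (outside J) = J"
    "inside J \<in> components (- J)" "outside J \<in> components (- J)"
proof -
  have s: "simple_path (g +++ q)"
    by (rule simple_path_join_loop) (use assms in \<open>auto simp: oarc_def\<close>)
  have J: "path_image (g +++ q) = J" using assms by (simp add: path_image_join)
  have lp: "pathfinish (g +++ q) = pathstart (g +++ q)" using assms by simp
  note jj = Jordan_inside_outside[OF s lp, unfolded J]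
  show "inside J \<noteq> {}" "open (inside J)" "connected (inside J)"
    "outside J \<noteq> {}" "open (outside J)" "connected (outside J)"
    "inside J \<inter> outside J = {}" "inside J \<union> outside J = - J"
    "frontier (inside J) = J" "frontier (outside J) = J"
    using jj by auto
  \<comment> \<open>A connected set properly larger than X would meet the frontier of X, which is
    \<open>J\<close>.\<close>
  have comp: "X \<in> components (- J)" if X: "open X" "connected X" "X \<noteq> {}" "X \<subseteq> - J" "frontier X = J" for X
    unfolding in_components_maximal
  proof (intro conjI allI impI)
    fix d assume d: "d \<noteq> {} \<and> X \<subseteq> d \<and> d \<subseteq> - J \<and> connected d"
    show "d = X"
    proof (rule ccontr)
      assume "d \<noteq> X"
      then have "d \<inter> frontier X \<noteq> {}"
        using d X(3) by (intro connected_Int_frontier) auto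
      then show False using d X(5) by auto
    qed
  qed (use X in auto)
  show "inside J \<in> components (- J)" "outside J \<in> components (- J)"
    using jj inside_no_overlap[of J] outside_no_overlap[of J] by (intro comp; blast)+
qed

text \<open>Enlarging the drawing may subdivide a face, but leaves a piece inside every face that it
  does not cover. Pieces of different faces are disjoint, so the number of faces does not
  drop.\<close>

lemma components_refine:
  fixes K K' :: "complex set"
  assumes "K \<subseteq> K'" "\<D> \<subseteq> components (- K)" "\<And>D. D \<in> \<D> \<Longrightarrow> \<not> D \<subseteq> K'"
  obtains f where "inj_on f \<D>" "\<And>D. D \<in> \<D> \<Longrightarrow> f D \<in> components (- K')" "\<And>D. D \<in> \<D> \<Longrightarrow> f D \<subseteq> D"
proof -
  have "\<exists>C. C \<in> components (- K') \<and> C \<subseteq> D" if D: "D \<in> \<D>" for D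
  proof -
    obtain x where x: "x \<in> D" "x \<notin> K'" using assms(3)[OF D] by auto
    let ?C = "connected_component_set (- K') x"
    have "?C \<in> components (- K')" using x by (simp add: componentsI)
    moreover have "?C \<subseteq> D"
    proof (rule components_maximal)
      show "D \<in> components (- K)" using D assms(2) by auto
      show "?C \<subseteq> - K" using connected_component_subset assms(1) by blast
      show "D \<inter> ?C \<noteq> {}" using x by auto
    qed simp
    ultimately show ?thesis by blast
  qed
  then obtain f where f: "\<And>D. D \<in> \<D> \<Longrightarrow> f D \<in> components (- K')" "\<And>D. D \<in> \<D> \<Longrightarrow> f D \<subseteq> D" by metis
  have "inj_on f \<D>"
  proof (rule inj_onI)
    fix D D' assume a: "D \<in> \<D>" "D' \<in> \<D>" "f D = f D'"
    have "f D \<noteq> {}" using f(1)[OF a(1)] by (rule in_components_nonempty)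
    then have "D \<inter> D' \<noteq> {}" using f(2)[OF a(1)] f(2)[OF a(2)] a(3) by auto
    then show "D = D'" using a assms(2) components_eq by blast
  qed
  then show ?thesis using that f by blast
qed

section \<open>Euler's inequality for systems of arcs\<close>

locale plane_arcs =
  fixes P :: "complex set" and E :: "'e set" and \<gamma> :: "'e \<Rightarrow> real \<Rightarrow> complex"
  assumes finite_P: "finite P" and finite_E: "finite E"
    and arcs: "e \<in> E \<Longrightarrow> arc (\<gamma> e)"
    and ends: "e \<in> E \<Longrightarrow> pathstart (\<gamma> e) \<in> P \<and> pathfinish (\<gamma> e) \<in> P"
    and oarc_P: "e \<in> E \<Longrightarrow> oarc (\<gamma> e) \<inter> P = {}"
    and oarc_E: "e \<in> E \<Longrightarrow> e' \<in> E \<Longrightarrow> e \<noteq> e' \<Longrightarrow> oarc (\<gamma> e) \<inter> path_image (\<gamma> e') = {}"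
begin

text \<open>All of \<open>P\<close>, isolated points included, belongs to every partial drawing, so
  the number of vertices stays fixed while edges are added.\<close>

definition drawn :: "'e set \<Rightarrow> complex set" where
  "drawn F = P \<union> (\<Union>e\<in>F. path_image (\<gamma> e))"

lemma drawn_mono: "F \<subseteq> F' \<Longrightarrow> drawn F \<subseteq> drawn F'"
  by (auto simp: drawn_def)

lemma compact_drawn: "F \<subseteq> E \<Longrightarrow> compact (drawn F)"
  unfolding drawn_def
  by (rule compact_Un[OF finite_imp_compact[OF finite_P] compact_UN])
     (auto intro: finite_subset finite_E compact_arc_image arcs)

lemma closed_drawn: "F \<subseteq> E \<Longrightarrow> closed (drawn F)"
  by (simp add: compact_drawn compact_imp_closed)

lemma oarc_drawn: "F \<subseteq> E \<Longrightarrow> e \<in> E - F \<Longrightarrow> oarc (\<gamma> e) \<inter> drawn F = {}"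
  using oarc_P oarc_E unfolding drawn_def by blast

lemma drawn_insert: "e \<in> E \<Longrightarrow> drawn (insert e F) = drawn F \<union> oarc (\<gamma> e)"
  using path_image_oarc[of "\<gamma> e"] ends[of e] by (auto simp: drawn_def)

text \<open>The new edge closes up to a Jordan curve, both sides of which come arbitrarily close to
  any interior point of the edge.\<close>

lemma new_edge_splits:
  assumes F: "F \<subseteq> E" and e: "e \<in> E - F"
    and pc: "path_component (drawn F) (pathfinish (\<gamma> e)) (pathstart (\<gamma> e))"
  obtains D A B where "D \<in> components (- drawn F)" "oarc (\<gamma> e) \<subseteq> D"
    "A \<in> components (- drawn (insert e F))" "B \<in> components (- drawn (insert e F))"
    "A \<noteq> B" "A \<subseteq> D" "B \<subseteq> D"
proof -
  let ?K = "drawn F" and ?K' = "drawn (insert e F)" and ?g = "\<gamma> e"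
  have g: "arc ?g" using e arcs by auto
  have opn: "open (- ?K)" using closed_drawn[OF F] by auto
  have odis: "oarc ?g \<inter> ?K = {}" using oarc_drawn F e by auto
  obtain p where p: "path p" "path_image p \<subseteq> ?K" "pathstart p = pathfinish ?g" "pathfinish p = pathstart ?g"
    using pc by (auto simp: path_component_def)
  have "pathfinish ?g \<noteq> pathstart ?g" using g arc_distinct_ends by metis
  then obtain q where q: "arc q" "path_image q \<subseteq> path_image p" "pathstart q = pathfinish ?g" "pathfinish q = pathstart ?g"
    using path_contains_arc[OF p(1) p(3) p(4)] by metis
  define J where "J = path_image ?g \<union> path_image q"
  have qd: "path_image q \<inter> oarc ?g = {}" using q(2) p(2) odis by auto
  note jj = jordan_arc_pair[OF g q(1,3,4) qd, folded J_def]
  have JK: "J \<subseteq> ?K'" unfolding J_def using q(2) p(2) drawn_mono[of F "insert e F"] by (auto simp: drawn_def)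
  obtain z where z: "z \<in> oarc ?g" using oarc_nonempty[OF g] by auto
  have zK: "z \<in> - ?K" using z odis by auto
  define D where "D = connected_component_set (- ?K) z"
  have D: "D \<in> components (- ?K)" unfolding D_def using zK by (rule componentsI)
  have "oarc ?g \<subseteq> D" unfolding D_def
    by (rule connected_component_maximal) (use z odis connected_oarc[OF g] in auto)
  obtain r where r: "r > 0" "ball z r \<subseteq> - ?K" using opn zK open_contains_ball by blast
  have ballD: "ball z r \<subseteq> D" unfolding D_def
    by (rule connected_component_maximal) (use r in auto)
  have "z \<in> J" using z oarc_subset J_def by auto
  then have "z \<in> closure (inside J)" "z \<in> closure (outside J)"
    using jj(9,10) by (auto simp: frontier_def)
  then obtain a b where a: "a \<in> inside J" "a \<in> ball z r" and b: "b \<in> outside J" "b \<in> ball z r"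
    using r(1) unfolding closure_approachable by (fastforce simp: dist_commute)
  define A where "A = connected_component_set (- ?K') a"
  define B where "B = connected_component_set (- ?K') b"
  \<comment> \<open>The ball misses the old drawing. Inside it only the new edge is drawn, and that
    edge is part of \<open>J\<close>.\<close>
  have nK': "x \<in> - ?K'" if "x \<in> ball z r" "x \<notin> J" for x
    using that r(2) e drawn_insert[of e F] oarc_subset[of ?g] unfolding J_def by auto
  have aK: "a \<in> - ?K'" "b \<in> - ?K'"
    using nK' a b jj(8) by blast+
  have AB: "A \<in> components (- ?K')" "B \<in> components (- ?K')"
    unfolding A_def B_def using aK by (simp_all add: componentsI)
  have aA: "a \<in> A" and bB: "b \<in> B" using aK by (simp_all add: A_def B_def)
  have AJ: "A \<subseteq> inside J"
    by (rule components_maximal[OF jj(11)])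
       (use AB(1) in_components_connected in_components_subset[OF AB(1)] JK a aK aA in \<open>auto\<close>)
  have BJ: "B \<subseteq> outside J"
    by (rule components_maximal[OF jj(12)])
       (use AB(2) in_components_connected in_components_subset[OF AB(2)] JK b aK bB in \<open>auto\<close>)
  have ne: "A \<noteq> B" using AJ BJ jj(7) AB in_components_nonempty by (metis Int_subset_iff subset_empty)
  have sub: "C \<subseteq> D" if C: "C \<in> components (- ?K')" "x \<in> C" "x \<in> ball z r" for C x
    by (rule components_maximal[OF D])
       (use C in_components_connected[OF C(1)] in_components_subset[OF C(1)] ballD drawn_mono[of F "insert e F"] in \<open>auto\<close>)
  have "A \<subseteq> D" "B \<subseteq> D" using sub[OF AB(1) aA] sub[OF AB(2) bB] a b by auto
  then show ?thesis using that D \<open>oarc ?g \<subseteq> D\<close> AB ne by blast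
qed

lemma component_not_subset_insert:
  assumes F: "F \<subseteq> E" and e: "e \<in> E" and D: "D \<in> components (- drawn F)"
  shows "\<not> D \<subseteq> drawn (insert e F)"
proof
  assume "D \<subseteq> drawn (insert e F)"
  then have "D \<subseteq> oarc (\<gamma> e)"
    using in_components_subset[OF D] drawn_insert[OF e] by auto
  then have "D \<subseteq> path_image (\<gamma> e)" using oarc_subset by blast
  moreover have "open D" using D closed_drawn[OF F] open_components[of "- drawn F" D] by auto
  ultimately show False using arc_image_not_open[OF arcs[OF e], of D] in_components_nonempty[OF D] by simp
qed

text \<open>The labels r separate the connected components of the drawing, so their number is the
  term of Euler's formula that counts components.\<close>

lemma euler_labelled:
  assumes "F \<subseteq> E"
  shows "\<exists>\<D> r. finite \<D> \<and> \<D> \<subseteq> components (- drawn F)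
    \<and> (\<forall>x\<in>P. \<forall>y\<in>P. r x = (r y :: complex) \<longrightarrow> path_component (drawn F) x y)
    \<and> card F + 1 + card (r ` P) \<le> card \<D> + card P"
  using finite_subset[OF assms finite_E] assms
proof (induction F rule: finite_induct)
  case empty
  have "- drawn {} \<noteq> {}"
    using ex_new_if_finite[OF infinite_UNIV_char_0 finite_P] by (auto simp: drawn_def)
  then obtain C where "C \<in> components (- drawn {})" by fastforce
  \<comment> \<open>One face and pairwise different labels: equality holds at the start.\<close>
  then show ?case
    by (intro exI[of _ "{C}"] exI[of _ id]) (auto simp: drawn_def path_component_refl)
next
  case (insert e F)
  then obtain \<D> and r :: "complex \<Rightarrow> complex" where IH: "finite \<D>" "\<D> \<subseteq> components (- drawn F)"
    "\<And>x y. x \<in> P \<Longrightarrow> y \<in> P \<Longrightarrow> r x = r y \<Longrightarrow> path_component (drawn F) x y"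
    "card F + 1 + card (r ` P) \<le> card \<D> + card P"
  proof -
    have "F \<subseteq> E" using insert.prems by simp
    from insert.IH[OF this] show ?thesis using that by (elim exE conjE) blast
  qed
  have e: "e \<in> E - F" and F: "F \<subseteq> E" using insert by auto
  let ?K' = "drawn (insert e F)"
  have mono: "drawn F \<subseteq> ?K'" by (rule drawn_mono) auto
  let ?x = "pathstart (\<gamma> e)" and ?y = "pathfinish (\<gamma> e)"
  have xy: "?x \<in> P" "?y \<in> P" using ends e by auto
  obtain f where f: "inj_on f \<D>" "\<And>D. D \<in> \<D> \<Longrightarrow> f D \<in> components (- ?K')" "\<And>D. D \<in> \<D> \<Longrightarrow> f D \<subseteq> D"
  proof (rule components_refine[OF mono IH(2)])
    show "\<not> D \<subseteq> ?K'" if "D \<in> \<D>" for D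
      using component_not_subset_insert[OF F _ subsetD[OF IH(2) that]] e by simp
  qed (use that in blast)
  show ?case
  proof (cases "r ?x = r ?y")
    case True
    then have pc: "path_component (drawn F) ?y ?x" using IH(3) xy by simp
    obtain D A B where D: "D \<in> components (- drawn F)" "A \<in> components (- ?K')" "B \<in> components (- ?K')"
      "A \<noteq> B" "A \<subseteq> D" "B \<subseteq> D"
      using new_edge_splits[OF F e pc] by metis
    \<comment> \<open>The edge closes a curve, so the list of faces grows: \<open>D\<close>, if
      listed, is replaced by the two pieces \<open>A\<close> and \<open>B\<close>, and the pieces
      chosen in other faces are disjoint from \<open>D\<close>.\<close>
    define \<D>' where "\<D>' = f ` (\<D> - {D}) \<union> {A, B}"
    have nAB: "f D' \<noteq> A \<and> f D' \<noteq> B" if "D' \<in> \<D> - {D}" for D'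
    proof -
      have "D' \<inter> D = {}" using that D(1) IH(2) components_nonoverlap by (metis DiffD1 DiffD2 insertI1 subsetD)
      moreover have "f D' \<subseteq> D'" "f D' \<noteq> {}" using that f(3) in_components_nonempty[OF f(2)] by auto
      ultimately show ?thesis using D(5,6) by blast
    qed
    have "card \<D>' = card (f ` (\<D> - {D})) + card {A, B}"
      unfolding \<D>'_def by (rule card_Un_disjoint) (use IH(1) nAB in auto)
    also have "card (f ` (\<D> - {D})) = card (\<D> - {D})"
      by (rule card_image) (use f(1) inj_on_subset in blast)
    finally have "card \<D>' \<ge> card \<D> + 1" using D(4) IH(1) by (auto simp: card_Diff_singleton_if)
    moreover have "finite \<D>'" "\<D>' \<subseteq> components (- ?K')" using IH(1) f(2) D by (auto simp: \<D>'_def)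
    moreover have "card (insert e F) = card F + 1" using insert by simp
    moreover have "path_component ?K' x y" if "x \<in> P" "y \<in> P" "r x = r y" for x y
      using IH(3)[OF that] mono path_component_of_subset by blast
    ultimately show ?thesis using IH(4) by (intro exI[of _ \<D>'] exI[of _ r]) auto
  next
    case False
    \<comment> \<open>The edge joins two label classes. Merging them lowers the number of labels by
      at least one, which pays for the edge, while the faces are merely refined.\<close>
    define r' where "r' = (\<lambda>z. if r z = r ?y then r ?x else r z)"
    have "r' ` P \<subseteq> r ` P - {r ?y}" using False xy by (auto simp: r'_def)
    then have "card (r' ` P) \<le> card (r ` P - {r ?y})" using finite_P by (intro card_mono) auto
    moreover have "card (r ` P - {r ?y}) + 1 = card (r ` P)"
      using finite_P xy card_Suc_Diff1[of "r ` P" "r ?y"] by auto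
    moreover have "card (f ` \<D>) = card \<D>" using f(1) by (rule card_image)
    moreover have "card (insert e F) = card F + 1" using insert by simp
    moreover have "path_component ?K' x y" if "x \<in> P" "y \<in> P" "r' x = r' y" for x y
    proof -
      have m: "path_component ?K' u v" if "u \<in> P" "v \<in> P" "r u = r v" for u v
        using IH(3)[OF that] mono path_component_of_subset by blast
      have "path_component ?K' ?x ?y"
        unfolding path_component_def
        by (rule exI[of _ "\<gamma> e"]) (use arcs[of e] e in \<open>auto simp: arc_imp_path drawn_def\<close>)
      note t = this path_component_sym[OF this]
      have r'eq: "r' x = r' y" using that(3) .
      show ?thesis
      proof (cases "r x = r y")
        case True then show ?thesis using m that by blast
      next
        case ne: False
        then consider "r x = r ?y" "r y = r ?x" | "r y = r ?y" "r x = r ?x"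
          using r'eq by (auto simp: r'_def split: if_splits)
        then show ?thesis
        proof cases
          case 1 then show ?thesis
            using m[OF that(1) xy(2)] m[OF xy(1) that(2)] t path_component_trans by metis
        next
          case 2 then show ?thesis
            using m[OF that(1) xy(1)] m[OF xy(2) that(2)] t path_component_trans by metis
        qed
      qed
    qed
    moreover have "finite (f ` \<D>)" "f ` \<D> \<subseteq> components (- ?K')" using IH(1) f(2) by auto
    ultimately show ?thesis using IH(4) by (intro exI[of _ "f ` \<D>"] exI[of _ r']) auto
  qed
qed

lemma euler:
  assumes "F \<subseteq> E" "P \<noteq> {}"
  obtains \<D> where "finite \<D>" "\<D> \<subseteq> components (- drawn F)" "card F + 2 \<le> card \<D> + card P"
proof -
  obtain \<D> and r :: "complex \<Rightarrow> complex" where *: "finite \<D>" "\<D> \<subseteq> components (- drawn F)"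
    "card F + 1 + card (r ` P) \<le> card \<D> + card P"
    using euler_labelled[OF assms(1)] by blast
  have "card (r ` P) \<noteq> 0" using assms(2) finite_P by auto
  then show ?thesis using that[OF *(1,2)] *(3) by auto
qed

section \<open>Incidence of edges and faces\<close>

definition incident :: "'e set \<Rightarrow> complex set \<Rightarrow> 'e set" where
  "incident F D = {e\<in>F. closure D \<inter> oarc (\<gamma> e) \<noteq> {}}"

text \<open>The boundary of a face with at most one incident edge lies in a single arc and finitely
  many points. These do not separate the plane, so the face would be their whole complement and
  contain the interior of a second drawn edge.\<close>

lemma card_incident_ge_2:
  assumes F: "F \<subseteq> E" and D: "D \<in> components (- drawn F)" and card: "card F \<ge> 2"
  shows "card (incident F D) \<ge> 2"
proof (rule ccontr)
  assume neg: "\<not> ?thesis"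
  have fin: "finite F" using F finite_E finite_subset by blast
  have sub: "incident F D \<subseteq> F" by (auto simp: incident_def)
  then have "finite (incident F D)" using fin finite_subset by blast
  then have eq: "\<forall>a\<in>incident F D. \<forall>b\<in>incident F D. a = b"
    using neg card_le_Suc0_iff_eq[of "incident F D"] by simp
  have "\<exists>e0\<in>F. incident F D \<subseteq> {e0}"
  proof (cases "incident F D = {}")
    case True
    have "F \<noteq> {}" using card by auto
    then show ?thesis using True by blast
  next
    case False
    then obtain e0 where "e0 \<in> incident F D" by blast
    then show ?thesis using eq sub by blast
  qed
  then obtain e0 where e0: "e0 \<in> F" "incident F D \<subseteq> {e0}" by blast
  have "F \<noteq> {e0}" using card by auto
  then obtain e1 where e1: "e1 \<in> F" "e1 \<noteq> e0" using e0 by auto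
  have fr: "frontier D \<subseteq> drawn F" using frontier_of_components_closed_complement[OF closed_drawn[OF F] D] .
  have fr0: "frontier D \<subseteq> path_image (\<gamma> e0) \<union> P"
  proof
    fix z assume z: "z \<in> frontier D"
    show "z \<in> path_image (\<gamma> e0) \<union> P"
    proof (rule ccontr)
      assume n: "z \<notin> path_image (\<gamma> e0) \<union> P"
      then obtain e where e: "e \<in> F" "z \<in> path_image (\<gamma> e)" using z fr by (auto simp: drawn_def)
      then have "z \<in> oarc (\<gamma> e)" using n ends[of e] F path_image_oarc[of "\<gamma> e"] by auto
      then have "e \<in> incident F D" using e z by (auto simp: incident_def frontier_def)
      then show False using e0(2) e n by auto
    qed
  qed
  have a0: "arc (\<gamma> e0)" "arc (\<gamma> e1)" using arcs F e0 e1 by auto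
  have con0: "connected (- path_image (\<gamma> e0))"
    by (rule connected_arc_complement) (use a0 in auto)
  have "connected (- path_image (\<gamma> e0) - P)"
    by (rule connected_open_delete_finite)
       (use con0 finite_P a0 compact_arc_image compact_imp_closed in auto)
  moreover have "D \<subseteq> - path_image (\<gamma> e0) - P"
    using in_components_subset[OF D] e0(1) by (auto simp: drawn_def)
  ultimately have "- path_image (\<gamma> e0) - P \<subseteq> D"
  proof -
    assume c: "connected (- path_image (\<gamma> e0) - P)" and s: "D \<subseteq> - path_image (\<gamma> e0) - P"
    have "(- path_image (\<gamma> e0) - P) \<inter> D \<noteq> {}" using s in_components_nonempty[OF D] by auto
    then show ?thesis using connected_Int_frontier[OF c, of D] fr0 by blast
  qed
  moreover have "oarc (\<gamma> e1) \<subseteq> - path_image (\<gamma> e0) - P"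
    using oarc_E[of e1 e0] oarc_P[of e1] e0 e1 F by auto
  moreover have "oarc (\<gamma> e1) \<inter> D = {}"
    using in_components_subset[OF D] e1(1) oarc_subset[of "\<gamma> e1"] by (auto simp: drawn_def)
  ultimately show False using oarc_nonempty[OF a0(2)] by auto
qed

text \<open>On either side of a closed curve through e there is at most one face incident with e:
  by Janiszewski's theorem, neither the curve nor the rest of the drawing separates two such faces,
  and the two sets meet in an arc.\<close>

lemma incident_unique:
  assumes F: "F \<subseteq> E" and e: "e \<in> F"
    and q: "arc q" "path_image q \<subseteq> drawn (F - {e})"
      "pathstart q = pathfinish (\<gamma> e)" "pathfinish q = pathstart (\<gamma> e)"
    and D1: "D1 \<in> components (- drawn F)" "e \<in> incident F D1"
    and D2: "D2 \<in> components (- drawn F)" "e \<in> incident F D2"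
    and X: "connected X" "X \<subseteq> - (path_image (\<gamma> e) \<union> path_image q)" "D1 \<inter> X \<noteq> {}" "D2 \<inter> X \<noteq> {}"
  shows "D1 = D2"
proof -
  let ?g = "\<gamma> e" and ?T = "drawn (F - {e})"
  define J where "J = path_image ?g \<union> path_image q"
  have g: "arc ?g" using arcs e F by auto
  have KT: "drawn F = ?T \<union> oarc ?g" using drawn_insert[of e "F - {e}"] e F by (auto simp: insert_absorb)
  have odis: "oarc ?g \<inter> ?T = {}" by (rule oarc_drawn) (use e F in auto)
  have clT: "closed ?T" by (rule closed_drawn) (use F in auto)
  have KJ: "drawn F = J \<union> ?T"
    using KT q(2) path_image_oarc[of ?g] ends[of e] e F unfolding J_def by (auto simp: drawn_def)
  have JT: "J \<inter> ?T = path_image q"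
    using odis q(2,3,4) path_image_oarc[of ?g] pathstart_in_path_image[of q] pathfinish_in_path_image[of q]
    unfolding J_def by auto
  have comJ: "compact J" unfolding J_def using g q(1) by (auto intro: compact_arc_image)
  obtain z where z: "z \<in> oarc ?g" using oarc_nonempty[OF g] by auto
  \<comment> \<open>Once the edge is erased, every face incident with it is joined to the point
    \<open>z\<close> through the interior of the edge.\<close>
  have reach: "connected_component (- ?T) x z"
    if D: "D \<in> components (- drawn F)" "e \<in> incident F D" "x \<in> D" for D x
  proof -
    obtain w where w: "w \<in> closure D" "w \<in> oarc ?g" using D(2) by (auto simp: incident_def)
    have wT: "w \<in> - ?T" using w odis by auto
    have "connected (insert w D)"
      by (rule connected_intermediate_closure[OF in_components_connected[OF D(1)]])
         (use w closure_subset in auto)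
    moreover have "insert w D \<subseteq> - ?T" using wT in_components_subset[OF D(1)] KT by auto
    ultimately have "connected_component (- ?T) x w"
      using D(3) by (intro connected_componentI[of "insert w D"]) auto
    moreover have "connected_component (- ?T) w z"
      by (rule connected_componentI[OF connected_oarc[OF g]]) (use odis w z in auto)
    ultimately show ?thesis by (rule connected_component_trans)
  qed
  obtain x y where x: "x \<in> D1" "x \<in> X" and y: "y \<in> D2" "y \<in> X" using X by auto
  have "connected_component (- (J \<union> ?T)) x y"
  proof (rule Janiszewski[OF comJ clT])
    show "connected (J \<inter> ?T)" unfolding JT using q(1) by (rule connected_arc_image)
    show "connected_component (- J) x y"
      by (rule connected_componentI[OF X(1)]) (use X(2) x y J_def in auto)
    show "connected_component (- ?T) x y"
      using reach[OF D1 x(1)] reach[OF D2 y(1)] connected_component_trans connected_component_sym by metis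
  qed
  then obtain C where C: "connected C" "C \<subseteq> - drawn F" "x \<in> C" "y \<in> C"
    unfolding KJ connected_component_def by auto
  then have "C \<subseteq> D1" "C \<subseteq> D2"
    using components_maximal[OF D1(1) C(1,2)] components_maximal[OF D2(1) C(1,2)] x y by auto
  then show ?thesis using components_eq[OF D1(1) D2(1)] C(3) by auto
qed

text \<open>A topological form of not being a bridge: the ends of the edge remain joined after the
  edge is erased.\<close>

definition on_cycle :: "'e set \<Rightarrow> 'e \<Rightarrow> bool" where
  "on_cycle F e \<longleftrightarrow> (\<exists>q. arc q \<and> path_image q \<subseteq> drawn (F - {e})
     \<and> pathstart q = pathfinish (\<gamma> e) \<and> pathfinish q = pathstart (\<gamma> e))"

text \<open>The closed curve through the edge has two sides, every face lies on one of them, and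
  each side admits at most one face incident with the edge.\<close>

lemma card_incident_faces_le_2:
  assumes F: "F \<subseteq> E" and e: "e \<in> F" and cyc: "on_cycle F e"
    and \<D>: "finite \<D>" "\<D> \<subseteq> components (- drawn F)"
  shows "card {D\<in>\<D>. e \<in> incident F D} \<le> 2"
proof -
  obtain q where q: "arc q" "path_image q \<subseteq> drawn (F - {e})"
      "pathstart q = pathfinish (\<gamma> e)" "pathfinish q = pathstart (\<gamma> e)"
    using cyc by (auto simp: on_cycle_def)
  define J where "J = path_image (\<gamma> e) \<union> path_image q"
  have g: "arc (\<gamma> e)" using arcs e F by auto
  have "oarc (\<gamma> e) \<inter> drawn (F - {e}) = {}" by (rule oarc_drawn) (use e F in auto)
  then have qd: "path_image q \<inter> oarc (\<gamma> e) = {}" using q(2) by auto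
  note jj = jordan_arc_pair[OF g q(1,3,4) qd, folded J_def]
  let ?S = "{D\<in>\<D>. e \<in> incident F D}"
  have JK: "J \<subseteq> drawn F" using q(2) drawn_mono[of "F - {e}" F] e unfolding J_def by (auto simp: drawn_def)
  have le1: "card {D\<in>?S. D \<inter> X \<noteq> {}} \<le> 1" if "connected X" "X \<subseteq> - J" for X
  proof -
    have "D1 = D2" if "D1 \<in> {D\<in>?S. D \<inter> X \<noteq> {}}" "D2 \<in> {D\<in>?S. D \<inter> X \<noteq> {}}" for D1 D2
      by (rule incident_unique[OF F e q, of _ _ X])
         (use that \<D>(2) \<open>connected X\<close> \<open>X \<subseteq> - J\<close> in \<open>auto simp: J_def\<close>)
    then show ?thesis using \<D>(1) by (auto simp: card_le_Suc0_iff_eq)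
  qed
  have "?S \<subseteq> {D\<in>?S. D \<inter> inside J \<noteq> {}} \<union> {D\<in>?S. D \<inter> outside J \<noteq> {}}"
  proof
    fix D assume D: "D \<in> ?S"
    then have c: "D \<in> components (- drawn F)" using \<D> by auto
    have "D \<subseteq> inside J \<union> outside J" unfolding jj(8) using in_components_subset[OF c] JK by auto
    then show "D \<in> {D\<in>?S. D \<inter> inside J \<noteq> {}} \<union> {D\<in>?S. D \<inter> outside J \<noteq> {}}"
      using D in_components_nonempty[OF c] by (simp only: mem_Collect_eq Un_iff) blast
  qed
  then have "card ?S \<le> card ({D\<in>?S. D \<inter> inside J \<noteq> {}} \<union> {D\<in>?S. D \<inter> outside J \<noteq> {}})"
    using \<D>(1) by (intro card_mono) auto
  also have "\<dots> \<le> card {D\<in>?S. D \<inter> inside J \<noteq> {}} + card {D\<in>?S. D \<inter> outside J \<noteq> {}}"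
    by (rule card_Un_le)
  also have "\<dots> \<le> 1 + 1"
    by (intro add_mono le1) (use jj(3,6) inside_no_overlap[of J] outside_no_overlap[of J] in blast)+
  finally show ?thesis by simp
qed

text \<open>Double counting of incidences: every edge lies on at most two faces, while a pentagonal face
  has five edges and every other face at least two. The crude bound two already suffices.\<close>

lemma card_pentagonal_faces:
  assumes F: "F \<subseteq> E" and "P \<noteq> {}" and card: "card F \<ge> 2"
    and cyc: "\<And>e. e \<in> F \<Longrightarrow> on_cycle F e"
    and \<Q>: "finite \<Q>" "\<Q> \<subseteq> components (- drawn F)" "\<And>D. D \<in> \<Q> \<Longrightarrow> card (incident F D) \<ge> 5"
  shows "3 * card \<Q> + 4 \<le> 2 * card P"
proof -
  obtain \<D>0 where \<D>0: "finite \<D>0" "\<D>0 \<subseteq> components (- drawn F)" "card F + 2 \<le> card \<D>0 + card P"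
    using euler[OF F \<open>P \<noteq> {}\<close>] by blast
  \<comment> \<open>The faces supplied by Euler's inequality need not include the pentagonal ones;
    adding these only strengthens the inequality.\<close>
  define \<D> where "\<D> = \<D>0 \<union> \<Q>"
  have \<D>: "finite \<D>" "\<D> \<subseteq> components (- drawn F)" "\<Q> \<subseteq> \<D>" using \<D>0 \<Q> by (auto simp: \<D>_def)
  have "card \<D>0 \<le> card \<D>" using \<D>(1) by (intro card_mono) (auto simp: \<D>_def)
  then have eul: "card F + 2 \<le> card \<D> + card P" using \<D>0(3) by auto
  have fin: "finite F" using F finite_E finite_subset by blast
  have "(\<Sum>D\<in>\<D>. card (incident F D)) = (\<Sum>D\<in>\<D>. \<Sum>e\<in>F. if e \<in> incident F D then 1 else 0)"
    using fin by (intro sum.cong refl) (auto simp: incident_def sum.If_cases intro!: arg_cong[where f=card])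
  also have "\<dots> = (\<Sum>e\<in>F. \<Sum>D\<in>\<D>. if e \<in> incident F D then 1 else 0)" by (rule sum.swap)
  also have "\<dots> = (\<Sum>e\<in>F. card {D\<in>\<D>. e \<in> incident F D})"
    using \<D>(1) by (intro sum.cong refl) (auto simp: sum.If_cases intro!: arg_cong[where f=card])
  also have "\<dots> \<le> (\<Sum>e\<in>F. 2)"
    by (intro sum_mono card_incident_faces_le_2 F cyc \<D>)
  finally have up: "(\<Sum>D\<in>\<D>. card (incident F D)) \<le> 2 * card F" by simp
  have "3 * card \<Q> + 2 * card \<D> = (\<Sum>D\<in>\<D>. if D \<in> \<Q> then 5 else 2)"
  proof -
    have "card \<D> = card \<Q> + card (\<D> - \<Q>)"
      using \<D> \<Q>(1) by (metis card_Diff_subset card_mono le_add_diff_inverse)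
    then show ?thesis using \<D> by (simp add: sum.If_cases Int_absorb1 Diff_eq)
  qed
  also have "\<dots> \<le> (\<Sum>D\<in>\<D>. card (incident F D))"
    using \<Q>(3) card_incident_ge_2[OF F _ card] \<D>(2) by (intro sum_mono) auto
  \<comment> \<open>With the incidence bound 2 * \<open>card F\<close> and Euler's inequality, the
    term 2 * \<open>card \<D>\<close> occurs on both sides and cancels.\<close>
  finally show ?thesis using up eul by linarith
qed

end

section \<open>Five-cycles in graphs without four-cycles\<close>

definition C4_free :: "'a sgraph \<Rightarrow> bool" where
  "C4_free G \<longleftrightarrow> \<not> (\<exists>a b c d. distinct [a, b, c, d] \<and>
     {a, b} \<in> edges G \<and> {b, c} \<in> edges G \<and> {c, d} \<in> edges G \<and> {d, a} \<in> edges G)"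

definition pentagon :: "'a sgraph \<Rightarrow> 'a \<Rightarrow> 'a \<Rightarrow> 'a \<Rightarrow> 'a \<Rightarrow> 'a \<Rightarrow> bool" where
  "pentagon G a b c d e \<longleftrightarrow> distinct [a, b, c, d, e] \<and>
     {a, b} \<in> edges G \<and> {b, c} \<in> edges G \<and> {c, d} \<in> edges G \<and> {d, e} \<in> edges G \<and> {e, a} \<in> edges G"

text \<open>Five-cycles are recorded by their vertex sets, which loses nothing in the absence of
  four-cycles, since they are then induced.\<close>

definition pents :: "'a sgraph \<Rightarrow> 'a set set" where
  "pents G = {{a, b, c, d, e} | a b c d e. pentagon G a b c d e}"

lemma C4_freeD:
  "C4_free G \<Longrightarrow> {a, b} \<in> edges G \<Longrightarrow> {b, c} \<in> edges G \<Longrightarrow> {c, d} \<in> edges G \<Longrightarrow> {d, a} \<in> edges G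
    \<Longrightarrow> distinct [a, b, c, d] \<Longrightarrow> False"
  unfolding C4_free_def by blast

lemma simple_graph_edgeE:
  assumes "simple_graph G" "x \<in> edges G"
  obtains u v where "u \<in> verts G" "v \<in> verts G" "u \<noteq> v" "x = {u, v}"
  using assms unfolding simple_graph_def by blast

lemma edge_endpoints:
  assumes "simple_graph G" "{u, v} \<in> edges G"
  shows "u \<in> verts G" "v \<in> verts G" "u \<noteq> v"
  using assms by (auto elim!: simple_graph_edgeE simp: doubleton_eq_iff)

lemma finite_edges:
  assumes "simple_graph G" shows "finite (edges G)"
proof (rule finite_subset)
  show "edges G \<subseteq> Pow (verts G)" using assms by (auto elim!: simple_graph_edgeE)
  show "finite (Pow (verts G))" using assms by (simp add: simple_graph_def)
qed

lemma pentagon_rotate: "pentagon G a b c d e \<Longrightarrow> pentagon G b c d e a"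
  by (auto simp: pentagon_def)

lemma pentagon_reflect: "pentagon G a b c d e \<Longrightarrow> pentagon G a e d c b"
  by (auto simp: pentagon_def insert_commute)

text \<open>The chord together with the longer of the two paths between its ends is a four-cycle.
  The other four chords follow by rotation.\<close>

lemma pentagon_no_chord:
  assumes "C4_free G" "pentagon G a b c d e" shows "{a, c} \<notin> edges G"
  using C4_freeD[OF assms(1), of a c d e] assms(2) by (auto simp: pentagon_def)

lemma pentagon_induced:
  assumes G: "simple_graph G" "C4_free G" and p: "pentagon G a b c d e"
  shows "{x\<in>edges G. x \<subseteq> {a, b, c, d, e}} = {{a, b}, {b, c}, {c, d}, {d, e}, {e, a}}"
proof -
  note r1 = pentagon_rotate[OF p] note r2 = pentagon_rotate[OF r1]
  note r3 = pentagon_rotate[OF r2] note r4 = pentagon_rotate[OF r3]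
  note ch = pentagon_no_chord[OF G(2) p] pentagon_no_chord[OF G(2) r1] pentagon_no_chord[OF G(2) r2]
    pentagon_no_chord[OF G(2) r3] pentagon_no_chord[OF G(2) r4]
  have ch': "{c, a} \<notin> edges G" "{d, b} \<notin> edges G" "{e, c} \<notin> edges G" "{a, d} \<notin> edges G" "{b, e} \<notin> edges G"
    using ch by (simp_all only: insert_commute not_False_eq_True)
  have "x \<in> {{a, b}, {b, c}, {c, d}, {d, e}, {e, a}}" if x: "x \<in> edges G" "x \<subseteq> {a, b, c, d, e}" for x
  proof -
    obtain u v where uv: "u \<noteq> v" "x = {u, v}" using x(1) G(1) by (auto elim: simple_graph_edgeE)
    have uv': "u \<in> {a, b, c, d, e}" "v \<in> {a, b, c, d, e}" using x(2) uv(2) by auto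
    have "\<forall>u\<in>{a, b, c, d, e}. \<forall>v\<in>{a, b, c, d, e}. u \<noteq> v \<longrightarrow> {u, v} \<in> edges G \<longrightarrow>
        {u, v} \<in> {{a, b}, {b, c}, {c, d}, {d, e}, {e, a}}"
      using ch ch' by (simp add: doubleton_eq_iff)
    from bspec[OF bspec[OF this uv'(1)] uv'(2), THEN mp, OF uv(1)]
    have "{u, v} \<in> edges G \<longrightarrow> {u, v} \<in> {{a, b}, {b, c}, {c, d}, {d, e}, {e, a}}" .
    then show ?thesis using x(1) uv(2) by simp
  qed
  then have "{x\<in>edges G. x \<subseteq> {a, b, c, d, e}} \<subseteq> {{a, b}, {b, c}, {c, d}, {d, e}, {e, a}}"
    by (intro subsetI) (simp only: mem_Collect_eq)
  moreover have "{{a, b}, {b, c}, {c, d}, {d, e}, {e, a}} \<subseteq> {x\<in>edges G. x \<subseteq> {a, b, c, d, e}}"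
    using p by (simp add: pentagon_def)
  ultimately show ?thesis by (rule subset_antisym)
qed

lemma pentsI: "pentagon G a b c d e \<Longrightarrow> {a, b, c, d, e} \<in> pents G"
  unfolding pents_def by (intro CollectI exI conjI, rule refl)

lemma pentsE:
  assumes "S \<in> pents G" obtains a b c d e where "pentagon G a b c d e" "S = {a, b, c, d, e}"
  using assms unfolding pents_def mem_Collect_eq by (elim exE conjE) (rule that)

lemma pents_subset_verts:
  assumes "simple_graph G" "S \<in> pents G" shows "S \<subseteq> verts G" "card S = 5"
proof -
  obtain a b c d e where p: "pentagon G a b c d e" and S: "S = {a, b, c, d, e}"
    by (rule pentsE[OF assms(2)])
  show "S \<subseteq> verts G" using p edge_endpoints[OF assms(1)] unfolding S pentagon_def by blast
  show "card S = 5" using p unfolding S pentagon_def by auto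
qed

lemma finite_pents:
  assumes "simple_graph G" shows "finite (pents G)"
proof (rule finite_subset)
  show "pents G \<subseteq> Pow (verts G)" using pents_subset_verts[OF assms] by auto
  show "finite (Pow (verts G))" using assms by (simp add: simple_graph_def)
qed

section \<open>Copies of cycles in terms of vertex tuples\<close>

lemma edges_cycle_graph: "edges (cycle_graph t) = (\<lambda>i. {i, (i + 1) mod t}) ` {..<t}"
  by (auto simp: cycle_graph_def)

lemma verts_cycle_4: "verts (cycle_graph 4) = {0, 1, 2, 3}"
  by (auto simp: cycle_graph_def)

lemma edges_cycle_4: "edges (cycle_graph 4) = {{0, 1}, {1, 2}, {2, 3}, {3, 0}}"
proof -
  have *: "{..<4} = {0, 1, 2, 3 :: nat}" by auto
  have m: "(0 + 1) mod 4 = (1 :: nat)" "(1 + 1) mod 4 = (2 :: nat)" "(2 + 1) mod 4 = (3 :: nat)" "(3 + 1) mod 4 = (0 :: nat)" by simp_all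
  show ?thesis unfolding edges_cycle_graph * image_insert image_empty m by (rule refl)
qed

lemma verts_cycle_5: "verts (cycle_graph 5) = {0, 1, 2, 3, 4}"
  by (auto simp: cycle_graph_def)

lemma edges_cycle_5: "edges (cycle_graph 5) = {{0, 1}, {1, 2}, {2, 3}, {3, 4}, {4, 0}}"
proof -
  have *: "{..<5} = {0, 1, 2, 3, 4 :: nat}" by auto
  have m: "(0 + 1) mod 5 = (1 :: nat)" "(1 + 1) mod 5 = (2 :: nat)" "(2 + 1) mod 5 = (3 :: nat)" "(3 + 1) mod 5 = (4 :: nat)" "(4 + 1) mod 5 = (0 :: nat)" by simp_all
  show ?thesis unfolding edges_cycle_graph * image_insert image_empty m by (rule refl)
qed

lemma free_of_cycle_4:
  assumes G: "simple_graph G"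
  shows "free_of G (cycle_graph 4) \<longleftrightarrow> C4_free G"
proof
  assume free: "free_of G (cycle_graph 4)"
  show "C4_free G" unfolding C4_free_def
  proof (intro notI, elim exE conjE)
    fix a b c d assume dist: "distinct [a, b, c, d]"
      and E: "{a, b} \<in> edges G" "{b, c} \<in> edges G" "{c, d} \<in> edges G" "{d, a} \<in> edges G"
    let ?K = "\<lparr>verts = {a, b, c, d}, edges = {{a, b}, {b, c}, {c, d}, {d, a}}\<rparr>"
    let ?f = "\<lambda>i. [a, b, c, d] ! i"
    have "subgraph_of ?K G"
      using dist E edge_endpoints[OF G] unfolding subgraph_of_def by (auto simp: simple_graph_def)
    moreover have "isomorphic (cycle_graph 4) ?K"
      unfolding isomorphic_def
    proof (intro exI[of _ ?f] conjI)
      show "bij_betw ?f (verts (cycle_graph 4)) (verts ?K)"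
        unfolding verts_cycle_4 bij_betw_def using dist by (auto simp: inj_on_def)
      show "edges ?K = (`) ?f ` edges (cycle_graph 4)"
        unfolding edges_cycle_4 by simp
    qed
    ultimately show False using free unfolding free_of_def by blast
  qed
next
  assume free: "C4_free G"
  show "free_of G (cycle_graph 4)" unfolding free_of_def isomorphic_def
  proof (intro notI, elim exE conjE)
    fix K f assume K: "subgraph_of K G" and f: "bij_betw f (verts (cycle_graph 4)) (verts K)"
      and E: "edges K = (`) f ` edges (cycle_graph 4)"
    have "{{f 0, f 1}, {f 1, f 2}, {f 2, f 3}, {f 3, f 0}} \<subseteq> edges G"
      using K E unfolding subgraph_of_def edges_cycle_4 by auto
    moreover have "distinct [f 0, f 1, f 2, f 3]"
      using f unfolding bij_betw_def verts_cycle_4 inj_on_def by auto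
    ultimately show False using C4_freeD[OF free, of "f 0" "f 1" "f 2" "f 3"] by blast
  qed
qed

lemma copies_cycle_5:
  assumes G: "simple_graph G"
  shows "K \<in> copies (cycle_graph 5) G \<longleftrightarrow> (\<exists>a b c d e. pentagon G a b c d e \<and>
    verts K = {a, b, c, d, e} \<and> edges K = {{a, b}, {b, c}, {c, d}, {d, e}, {e, a}})" (is "_ = ?R")
proof
  assume "K \<in> copies (cycle_graph 5) G"
  then obtain f where K: "subgraph_of K G" and f: "bij_betw f (verts (cycle_graph 5)) (verts K)"
      and E: "edges K = (`) f ` edges (cycle_graph 5)" by (auto simp: copies_def isomorphic_def)
  have E': "edges K = {{f 0, f 1}, {f 1, f 2}, {f 2, f 3}, {f 3, f 4}, {f 4, f 0}}"
    using E unfolding edges_cycle_5 by simp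
  have V: "verts K = {f 0, f 1, f 2, f 3, f 4}"
    using f unfolding bij_betw_def verts_cycle_5 by auto
  have d: "distinct [f 0, f 1, f 2, f 3, f 4]"
    using f unfolding bij_betw_def verts_cycle_5 inj_on_def by auto
  have "edges K \<subseteq> edges G" using K by (simp add: subgraph_of_def)
  then have "pentagon G (f 0) (f 1) (f 2) (f 3) (f 4)"
    using d unfolding pentagon_def E' by blast
  then show ?R using E' V by (intro exI conjI)
next
  assume ?R
  then obtain a b c d e where p: "pentagon G a b c d e" and V: "verts K = {a, b, c, d, e}"
    and E: "edges K = {{a, b}, {b, c}, {c, d}, {d, e}, {e, a}}" by (elim exE conjE) (rule that)
  have "verts K \<subseteq> verts G" unfolding V using p by (intro pents_subset_verts(1)[OF G] pentsI)
  then have "subgraph_of K G"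
    using p unfolding subgraph_of_def simple_graph_def V E by (auto simp: pentagon_def)
  moreover have "isomorphic (cycle_graph 5) K" unfolding isomorphic_def
  proof (intro exI[of _ "\<lambda>i. [a, b, c, d, e] ! i"] conjI)
    show "bij_betw (\<lambda>i. [a, b, c, d, e] ! i) (verts (cycle_graph 5)) (verts K)"
      unfolding verts_cycle_5 bij_betw_def V using p by (auto simp: inj_on_def pentagon_def)
    show "edges K = (`) ((!) [a, b, c, d, e]) ` edges (cycle_graph 5)"
      unfolding edges_cycle_5 E by simp
  qed
  ultimately show "K \<in> copies (cycle_graph 5) G" by (simp add: copies_def)
qed

lemma card_copies_cycle_5:
  assumes G: "simple_graph G" "C4_free G"
  shows "card (copies (cycle_graph 5) G) = card (pents G)"
proof (rule bij_betw_same_card[of verts], rule bij_betw_imageI)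
  have E: "edges K = {x\<in>edges G. x \<subseteq> verts K}" if "K \<in> copies (cycle_graph 5) G" for K
  proof -
    from that obtain a b c d e where p: "pentagon G a b c d e" and V: "verts K = {a, b, c, d, e}"
      and E: "edges K = {{a, b}, {b, c}, {c, d}, {d, e}, {e, a}}"
      unfolding copies_cycle_5[OF G(1)] by (elim exE conjE) (rule that)
    show ?thesis unfolding V E using pentagon_induced[OF G p] by simp
  qed
  show "inj_on verts (copies (cycle_graph 5) G)"
  proof (rule inj_onI)
    fix K L assume "K \<in> copies (cycle_graph 5) G" "L \<in> copies (cycle_graph 5) G" "verts K = verts L"
    then show "K = L" using E[of K] E[of L] by (intro sgraph.equality) auto
  qed
  show "verts ` copies (cycle_graph 5) G = pents G"
  proof
    show "verts ` copies (cycle_graph 5) G \<subseteq> pents G"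
    proof (rule image_subsetI)
      fix K assume "K \<in> copies (cycle_graph 5) G"
      then obtain a b c d e where "pentagon G a b c d e" and V: "verts K = {a, b, c, d, e}"
        unfolding copies_cycle_5[OF G(1)] by (elim exE conjE) (rule that)
      then show "verts K \<in> pents G" by (simp only: pentsI)
    qed
    show "pents G \<subseteq> verts ` copies (cycle_graph 5) G"
    proof
      fix S assume "S \<in> pents G"
      then obtain a b c d e where p: "pentagon G a b c d e" "S = {a, b, c, d, e}" by (rule pentsE)
      let ?K = "\<lparr>verts = S, edges = {{a, b}, {b, c}, {c, d}, {d, e}, {e, a}}\<rparr>"
      have "?K \<in> copies (cycle_graph 5) G" unfolding copies_cycle_5[OF G(1)] by (intro exI conjI, rule p(1)) (simp_all add: p(2))
      then show "S \<in> verts ` copies (cycle_graph 5) G" by force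
    qed
  qed
qed

section \<open>Induced subgraphs and positions on a five-cycle\<close>

definition induce :: "'a sgraph \<Rightarrow> 'a set \<Rightarrow> 'a sgraph" where
  "induce G W = \<lparr>verts = W, edges = {x\<in>edges G. x \<subseteq> W}\<rparr>"

lemma simple_graph_induce:
  assumes "simple_graph G" "W \<subseteq> verts G" shows "simple_graph (induce G W)"
proof -
  have "finite W" using assms finite_subset by (auto simp: simple_graph_def)
  then show ?thesis using assms(1) unfolding simple_graph_def induce_def by fastforce
qed

lemma planar_induce:
  assumes "planar G" "W \<subseteq> verts G" shows "planar (induce G W)"
proof -
  obtain p \<gamma> where d: "plane_drawing G p \<gamma>" using assms(1) by (auto simp: planar_def)
  have sub: "p ` W \<subseteq> p ` verts G" using assms(2) by auto
  have "plane_drawing (induce G W) p \<gamma>"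
    unfolding plane_drawing_def induce_def sgraph.simps
  proof (intro conjI ballI impI)
    show "inj_on p W" using d assms(2) inj_on_subset by (auto simp: plane_drawing_def)
    fix x assume x: "x \<in> {x\<in>edges G. x \<subseteq> W}"
    show "arc (\<gamma> x)" "{pathstart (\<gamma> x), pathfinish (\<gamma> x)} = p ` x"
      using d x by (simp_all add: plane_drawing_def)
    have "(path_image (\<gamma> x) - p ` x) \<inter> p ` verts G = {}" using d x by (simp add: plane_drawing_def)
    then show "(path_image (\<gamma> x) - p ` x) \<inter> p ` W = {}" using sub by blast
    fix y assume "y \<in> {x\<in>edges G. x \<subseteq> W}" "x \<noteq> y"
    then show "(path_image (\<gamma> x) - p ` x) \<inter> path_image (\<gamma> y) = {}"
      using d x by (simp add: plane_drawing_def)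
  qed
  then show ?thesis by (auto simp: planar_def)
qed

lemma C4_free_induce: "C4_free G \<Longrightarrow> C4_free (induce G W)"
  unfolding C4_free_def induce_def by auto

lemma pents_induce: "pents (induce G W) = {S\<in>pents G. S \<subseteq> W}"
proof (intro set_eqI iffI)
  fix S assume "S \<in> pents (induce G W)"
  then obtain a b c d e where p: "pentagon (induce G W) a b c d e" and S: "S = {a, b, c, d, e}"
    by (rule pentsE)
  then have "pentagon G a b c d e" "{a, b, c, d, e} \<subseteq> W" by (simp_all add: pentagon_def induce_def)
  then show "S \<in> {S\<in>pents G. S \<subseteq> W}" unfolding S by (simp only: pentsI mem_Collect_eq)
next
  fix S assume "S \<in> {S\<in>pents G. S \<subseteq> W}"
  then have "S \<in> pents G" and W: "S \<subseteq> W" by auto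
  then obtain a b c d e where p: "pentagon G a b c d e" and S: "S = {a, b, c, d, e}"
    by (elim pentsE)
  have "pentagon (induce G W) a b c d e" using p W unfolding S by (simp add: pentagon_def induce_def)
  then show "S \<in> pents (induce G W)" unfolding S by (rule pentsI)
qed

text \<open>Rotation brings any prescribed edge to the front, so that later arguments treat only
  this position.\<close>

lemma pent_edge:
  assumes G: "simple_graph G" "C4_free G" and S: "S \<in> pents G" and x: "x \<in> edges G" "x \<subseteq> S"
  obtains a b c d e where "pentagon G a b c d e" "S = {a, b, c, d, e}" "x = {a, b}"
proof -
  obtain a b c d e where p: "pentagon G a b c d e" and S': "S = {a, b, c, d, e}"
    by (rule pentsE[OF S])
  note r1 = pentagon_rotate[OF p] note r2 = pentagon_rotate[OF r1]
  note r3 = pentagon_rotate[OF r2] note r4 = pentagon_rotate[OF r3]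
  have S1: "S = {b, c, d, e, a}" and S2: "S = {c, d, e, a, b}" and S3: "S = {d, e, a, b, c}"
    and S4: "S = {e, a, b, c, d}" using S' by auto
  have "x \<in> {{a, b}, {b, c}, {c, d}, {d, e}, {e, a}}"
    unfolding pentagon_induced[OF G p, symmetric] using x S' by simp
  then show ?thesis
    by (elim insertE emptyE)
      (rule that[OF p S'] that[OF r1 S1] that[OF r2 S2] that[OF r3 S3] that[OF r4 S4], assumption)+
qed

lemma pent_vertex:
  assumes S: "S \<in> pents G" and x: "x \<in> S"
  obtains b c d e where "pentagon G x b c d e" "S = {x, b, c, d, e}"
proof -
  obtain a b c d e where p: "pentagon G a b c d e" and S': "S = {a, b, c, d, e}"
    by (rule pentsE[OF S])
  note r1 = pentagon_rotate[OF p] note r2 = pentagon_rotate[OF r1]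
  note r3 = pentagon_rotate[OF r2] note r4 = pentagon_rotate[OF r3]
  have S1: "S = {b, c, d, e, a}" and S2: "S = {c, d, e, a, b}" and S3: "S = {d, e, a, b, c}"
    and S4: "S = {e, a, b, c, d}" using S' by auto
  consider "x = a" | "x = b" | "x = c" | "x = d" | "x = e" using x S' by auto
  then show ?thesis
  proof cases
    case 1 then show ?thesis using that p S' by simp
  next
    case 2 then show ?thesis using that r1 S1 by simp
  next
    case 3 then show ?thesis using that r2 S2 by simp
  next
    case 4 then show ?thesis using that r3 S3 by simp
  next
    case 5 then show ?thesis using that r4 S4 by simp
  qed
qed

text \<open>Non-adjacent vertices of a five-cycle already have a common neighbour on it; a second
  one off the cycle would complete a four-cycle.\<close>

lemma pent_common_neighbour:
  assumes G: "simple_graph G" "C4_free G" and S: "S \<in> pents G" and xy: "x \<in> S" "y \<in> S" "x \<noteq> y"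
    and z: "z \<notin> S" "{x, z} \<in> edges G" "{z, y} \<in> edges G"
  shows "{x, y} \<in> edges G"
proof (rule ccontr)
  assume n: "{x, y} \<notin> edges G"
  obtain b c d e where p: "pentagon G x b c d e" and S': "S = {x, b, c, d, e}"
    using pent_vertex[OF S xy(1)] .
  have "y = c \<or> y = d" using n p xy S' by (auto simp: pentagon_def insert_commute)
  then show False
  proof
    assume "y = c"
    then show False using C4_freeD[OF G(2), of x z c b] z p S' by (auto simp: pentagon_def insert_commute)
  next
    assume "y = d"
    then show False using C4_freeD[OF G(2), of x z d e] z p S' by (auto simp: pentagon_def insert_commute)
  qed
qed

text \<open>If T crossed S, it would meet S in two non-adjacent vertices with a common neighbour off S.\<close>

lemma pents_noncrossing:
  assumes G: "simple_graph G" "C4_free G" and S: "S \<in> pents G" and T: "T \<in> pents G"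
    and AB: "verts G = S \<union> A \<union> B" "A \<inter> S = {}" "B \<inter> S = {}" "A \<inter> B = {}"
    and sep: "\<And>u v. u \<in> A \<Longrightarrow> v \<in> B \<Longrightarrow> {u, v} \<notin> edges G"
  shows "T \<subseteq> S \<union> A \<or> T \<subseteq> S \<union> B"
proof (rule ccontr)
  assume neg: "\<not> ?thesis"
  have TV: "T \<subseteq> S \<union> A \<union> B" using pents_subset_verts(1)[OF G(1) T] AB(1) by simp
  obtain t where t: "t \<in> T" "t \<in> A" "t \<notin> S" using neg TV AB by blast
  obtain t' where t': "t' \<in> T" "t' \<in> B" "t' \<notin> S" using neg TV AB by blast
  \<comment> \<open>The vertices t and t' lie strictly on different sides and at distance two on T.
    Both paths of T between them must pass through S: the short one at b, the long one at d or e. In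
    either case two non-adjacent vertices of T lie on S and have t or t' as a common neighbour,
    which would make them adjacent.\<close>
  have no: False if p: "pentagon G t b t' d e" and T': "T = {t, b, t', d, e}" for b d e
  proof -
    have E: "{t, b} \<in> edges G" "{b, t'} \<in> edges G" "{t', d} \<in> edges G" "{d, e} \<in> edges G" "{e, t} \<in> edges G"
      and ne: "b \<noteq> d" "b \<noteq> e"
      using p by (auto simp: pentagon_def)
    have sep': "{v, u} \<notin> edges G" if "u \<in> A" "v \<in> B" for u v
      using sep[OF that] by (simp add: insert_commute)
    have b: "b \<in> S" using E(1,2) sep sep' t t' T' TV by blast
    have "d \<in> S \<or> e \<in> S"
    proof (rule ccontr)
      assume "\<not> (d \<in> S \<or> e \<in> S)"
      then have "d \<in> A \<or> d \<in> B" "e \<in> A \<or> e \<in> B" using T' TV by auto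
      then show False using E(3,4,5) sep sep' t(2) t'(2) by metis
    qed
    then show False
    proof
      assume d: "d \<in> S"
      have "{b, d} \<in> edges G" by (rule pent_common_neighbour[OF G S b d ne(1) t'(3) E(2,3)])
      then show False using pentagon_no_chord[OF G(2) pentagon_rotate[OF p]] by simp
    next
      assume e: "e \<in> S"
      have "{b, e} \<in> edges G"
        by (rule pent_common_neighbour[OF G S b e ne(2) t(3)]) (use E(1,5) in \<open>simp_all add: insert_commute\<close>)
      then show False
        using pentagon_no_chord[OF G(2) pentagon_rotate[OF pentagon_rotate[OF pentagon_rotate[OF pentagon_rotate[OF p]]]]]
        by (simp add: insert_commute)
    qed
  qed
  obtain b c d e where p: "pentagon G t b c d e" and T': "T = {t, b, c, d, e}"
    using pent_vertex[OF T t(1)] .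
  have "t' \<noteq> t" using t(2) t'(2) AB(4) by blast
  then have "t' = c \<or> t' = d"
    using t'(1) T' p sep[OF t(2) t'(2)] by (auto simp: pentagon_def insert_commute)
  then show False
  proof
    assume "t' = c" then show False using no p T' by blast
  next
    assume "t' = d"
    moreover have "T = {t, e, d, c, b}" using T' by auto
    ultimately show False using no pentagon_reflect[OF p] by blast
  qed
qed

section \<open>The upper bound\<close>

locale plane_graph =
  fixes G :: "'a sgraph" and p \<gamma>
  assumes simple: "simple_graph G" and C4: "C4_free G" and drawing: "plane_drawing G p \<gamma>"
begin

lemma inj_p: "inj_on p (verts G)"
  using drawing by (simp add: plane_drawing_def)

lemma edge_arc: "x \<in> edges G \<Longrightarrow> arc (\<gamma> x)"
  and edge_ends: "x \<in> edges G \<Longrightarrow> {pathstart (\<gamma> x), pathfinish (\<gamma> x)} = p ` x"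
  using drawing by (simp_all add: plane_drawing_def)

lemma edge_oarc: "x \<in> edges G \<Longrightarrow> oarc (\<gamma> x) = path_image (\<gamma> x) - p ` x"
  unfolding oarc_def by (simp only: edge_ends)

lemma edge_subset_verts: "x \<in> edges G \<Longrightarrow> x \<subseteq> verts G"
  using simple by (auto elim!: simple_graph_edgeE)

lemma edge_ends_image: "x \<in> edges G \<Longrightarrow> p ` x \<subseteq> path_image (\<gamma> x)"
  unfolding edge_ends[symmetric] by (simp add: pathstart_in_path_image pathfinish_in_path_image)

lemma oarc_verts: "x \<in> edges G \<Longrightarrow> oarc (\<gamma> x) \<inter> p ` verts G = {}"
  using drawing by (simp add: plane_drawing_def edge_oarc)

lemma oarc_disjoint: "x \<in> edges G \<Longrightarrow> y \<in> edges G \<Longrightarrow> x \<noteq> y \<Longrightarrow> oarc (\<gamma> x) \<inter> path_image (\<gamma> y) = {}"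
  using drawing by (simp add: plane_drawing_def edge_oarc)

lemma edge_images_Int:
  assumes "x \<in> edges G" "y \<in> edges G" "x \<noteq> y"
  shows "path_image (\<gamma> x) \<inter> path_image (\<gamma> y) \<subseteq> p ` (x \<inter> y)"
proof -
  have "path_image (\<gamma> x) \<inter> path_image (\<gamma> y) \<subseteq> p ` x \<inter> p ` y"
    using oarc_disjoint[OF assms] oarc_disjoint[OF assms(2,1) assms(3)[symmetric]]
    unfolding edge_oarc[OF assms(1)] edge_oarc[OF assms(2)] by blast
  also have "\<dots> = p ` (x \<inter> y)"
    using inj_on_image_Int[OF inj_p edge_subset_verts edge_subset_verts] assms by simp
  finally show ?thesis .
qed

lemma vertex_on_edge:
  assumes "x \<in> edges G" "v \<in> verts G" "p v \<in> path_image (\<gamma> x)" shows "v \<in> x"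
proof -
  have "p v \<in> p ` x" using oarc_verts[OF assms(1)] assms(2,3) unfolding edge_oarc[OF assms(1)] by blast
  then show ?thesis using inj_p edge_subset_verts[OF assms(1)] assms(2) by (simp add: inj_on_image_mem_iff)
qed

sublocale plane_arcs "p ` verts G" "edges G" \<gamma>
proof
  show "finite (p ` verts G)" using simple by (simp add: simple_graph_def)
  show "finite (edges G)" using simple by (rule finite_edges)
next
  fix x assume x: "x \<in> edges G"
  show "arc (\<gamma> x)" "oarc (\<gamma> x) \<inter> p ` verts G = {}" using x by (simp_all add: edge_arc oarc_verts)
  have "{pathstart (\<gamma> x), pathfinish (\<gamma> x)} \<subseteq> p ` verts G"
    unfolding edge_ends[OF x] using edge_subset_verts[OF x] by (rule image_mono)
  then show "pathstart (\<gamma> x) \<in> p ` verts G \<and> pathfinish (\<gamma> x) \<in> p ` verts G" by simp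
next
  fix x y assume "x \<in> edges G" "y \<in> edges G" "x \<noteq> y"
  then show "oarc (\<gamma> x) \<inter> path_image (\<gamma> y) = {}" by (rule oarc_disjoint)
qed

text \<open>A drawing fixes the ends of an edge only as an unordered pair; concatenation needs a
  direction.\<close>

lemma oriented_edge:
  assumes "{u, v} \<in> edges G"
  obtains h where "arc h" "pathstart h = p u" "pathfinish h = p v" "path_image h = path_image (\<gamma> {u, v})"
proof -
  let ?g = "\<gamma> {u, v}"
  have e: "{pathstart ?g, pathfinish ?g} = {p u, p v}" using edge_ends[OF assms] by simp
  then consider "pathstart ?g = p u" "pathfinish ?g = p v" | "pathstart ?g = p v" "pathfinish ?g = p u"
    unfolding doubleton_eq_iff by blast
  then show ?thesis
  proof cases
    case 1 then show ?thesis using that[of ?g] edge_arc[OF assms] by simp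
  next
    case 2 then show ?thesis using that[of "reversepath ?g"] edge_arc[OF assms] by (simp add: arc_reversepath)
  qed
qed

text \<open>The other four edges join to an arc because consecutive ones meet only in their common
  vertex and the others are disjoint. The arc is reversed if the drawing runs through the first edge
  from b to a.\<close>

lemma pentagon_arc:
  assumes pen: "pentagon G a b c d e"
  obtains q where "arc q" "pathstart q = pathfinish (\<gamma> {a, b})" "pathfinish q = pathstart (\<gamma> {a, b})"
    "path_image q = path_image (\<gamma> {b, c}) \<union> path_image (\<gamma> {c, d}) \<union> path_image (\<gamma> {d, e}) \<union> path_image (\<gamma> {e, a})"
proof -
  have E: "{a, b} \<in> edges G" "{b, c} \<in> edges G" "{c, d} \<in> edges G" "{d, e} \<in> edges G" "{e, a} \<in> edges G"
    and dis: "distinct [a, b, c, d, e]"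
    using pen by (simp_all add: pentagon_def)
  obtain h1 where h1: "arc h1" "pathstart h1 = p b" "pathfinish h1 = p c" "path_image h1 = path_image (\<gamma> {b, c})"
    using oriented_edge[OF E(2)] .
  obtain h2 where h2: "arc h2" "pathstart h2 = p c" "pathfinish h2 = p d" "path_image h2 = path_image (\<gamma> {c, d})"
    using oriented_edge[OF E(3)] .
  obtain h3 where h3: "arc h3" "pathstart h3 = p d" "pathfinish h3 = p e" "path_image h3 = path_image (\<gamma> {d, e})"
    using oriented_edge[OF E(4)] .
  obtain h4 where h4: "arc h4" "pathstart h4 = p e" "pathfinish h4 = p a" "path_image h4 = path_image (\<gamma> {e, a})"
    using oriented_edge[OF E(5)] .
  have ne: "{b, c} \<noteq> {c, d}" "{b, c} \<noteq> {d, e}" "{b, c} \<noteq> {e, a}" "{c, d} \<noteq> {d, e}" "{c, d} \<noteq> {e, a}" "{d, e} \<noteq> {e, a}"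
    using dis by (auto simp: doubleton_eq_iff)
  have Ints: "{b, c} \<inter> {c, d} = {c}" "{b, c} \<inter> {d, e} = {}" "{b, c} \<inter> {e, a} = {}" "{c, d} \<inter> {d, e} = {d}"
    "{c, d} \<inter> {e, a} = {}" "{d, e} \<inter> {e, a} = {e}"
    using dis by auto
  note I0 = edge_images_Int[OF E(2,3) ne(1)] edge_images_Int[OF E(2,4) ne(2)] edge_images_Int[OF E(2,5) ne(3)]
      edge_images_Int[OF E(3,4) ne(4)] edge_images_Int[OF E(3,5) ne(5)] edge_images_Int[OF E(4,5) ne(6)]
  have I: "path_image h1 \<inter> path_image h2 \<subseteq> {p c}" "path_image h1 \<inter> path_image h3 \<subseteq> {}"
    "path_image h1 \<inter> path_image h4 \<subseteq> {}" "path_image h2 \<inter> path_image h3 \<subseteq> {p d}"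
    "path_image h2 \<inter> path_image h4 \<subseteq> {}" "path_image h3 \<inter> path_image h4 \<subseteq> {p e}"
    using I0 unfolding h1 h2 h3 h4 Ints by simp_all
  have a3: "arc (h3 +++ h4)" by (rule arc_join) (use h3 h4 I in auto)
  have a2: "arc (h2 +++ (h3 +++ h4))"
    by (rule arc_join) (use a3 h2 h3 h4 I in \<open>auto simp: path_image_join\<close>)
  define r where "r = h1 +++ (h2 +++ (h3 +++ h4))"
  have r: "arc r" unfolding r_def
    by (rule arc_join) (use a2 h1 h2 h3 h4 I in \<open>auto simp: path_image_join\<close>)
  have r': "pathstart r = p b" "pathfinish r = p a"
    "path_image r = path_image (\<gamma> {b, c}) \<union> path_image (\<gamma> {c, d}) \<union> path_image (\<gamma> {d, e}) \<union> path_image (\<gamma> {e, a})"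
    unfolding r_def using h1 h2 h3 h4 by (simp_all add: path_image_join Un_assoc)
  have "{pathstart (\<gamma> {a, b}), pathfinish (\<gamma> {a, b})} = {p a, p b}" using edge_ends[OF E(1)] by simp
  then consider "pathstart (\<gamma> {a, b}) = p a" "pathfinish (\<gamma> {a, b}) = p b"
    | "pathstart (\<gamma> {a, b}) = p b" "pathfinish (\<gamma> {a, b}) = p a"
    unfolding doubleton_eq_iff by blast
  then show ?thesis
  proof cases
    case 1 then show ?thesis using that[of r] r r' by simp
  next
    case 2 then show ?thesis using that[of "reversepath r"] r r' by (simp add: arc_reversepath)
  qed
qed

text \<open>Depends on the vertex set alone. For a five-cycle this is exactly the drawn cycle, since
  there are no chords.\<close>

definition curve :: "'a set \<Rightarrow> complex set" where
  "curve S = (\<Union>x\<in>{x\<in>edges G. x \<subseteq> S}. path_image (\<gamma> x))"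

lemma pent_edge_arc:
  assumes S: "S \<in> pents G" and x: "x \<in> edges G" "x \<subseteq> S"
  obtains q where "arc q" "pathstart q = pathfinish (\<gamma> x)" "pathfinish q = pathstart (\<gamma> x)"
    "path_image q = (\<Union>y\<in>{y\<in>edges G. y \<subseteq> S} - {x}. path_image (\<gamma> y))"
    "curve S = path_image (\<gamma> x) \<union> path_image q"
    "path_image q \<inter> oarc (\<gamma> x) = {}"
proof -
  obtain a b c d e where pen: "pentagon G a b c d e" and S': "S = {a, b, c, d, e}" and x': "x = {a, b}"
    using pent_edge[OF simple C4 S x] .
  have dis: "distinct [a, b, c, d, e]" using pen by (simp add: pentagon_def)
  have ES: "{y\<in>edges G. y \<subseteq> S} = {{a, b}, {b, c}, {c, d}, {d, e}, {e, a}}"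
    unfolding S' by (rule pentagon_induced[OF simple C4 pen])
  have ESx: "{y\<in>edges G. y \<subseteq> S} - {x} = {{b, c}, {c, d}, {d, e}, {e, a}}"
    unfolding ES x' by (rule Diff_insert_absorb) (use dis in \<open>simp add: doubleton_eq_iff\<close>)
  obtain q where q: "arc q" "pathstart q = pathfinish (\<gamma> x)" "pathfinish q = pathstart (\<gamma> x)"
    "path_image q = path_image (\<gamma> {b, c}) \<union> path_image (\<gamma> {c, d}) \<union> path_image (\<gamma> {d, e}) \<union> path_image (\<gamma> {e, a})"
    using pentagon_arc[OF pen] unfolding x' .
  have im: "path_image q = (\<Union>y\<in>{y\<in>edges G. y \<subseteq> S} - {x}. path_image (\<gamma> y))"
    unfolding ESx q(4) by (simp add: Un_assoc)
  have "curve S = path_image (\<gamma> x) \<union> path_image q"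
    unfolding curve_def im using x by blast
  moreover have "path_image q \<inter> oarc (\<gamma> x) = {}"
    unfolding im using oarc_disjoint[OF x(1)] by blast
  ultimately show ?thesis using that q(1,2,3) im by blast
qed

lemma pent_has_edge:
  assumes S: "S \<in> pents G" and v: "v \<in> S" obtains x where "x \<in> edges G" "x \<subseteq> S" "v \<in> x"
proof -
  obtain b c d e where "pentagon G v b c d e" "S = {v, b, c, d, e}"
    using pent_vertex[OF S v] .
  then show ?thesis using that[of "{v, b}"] by (simp add: pentagon_def)
qed

lemma curve_jordan:
  assumes S: "S \<in> pents G"
  defines "J \<equiv> curve S"
  shows "inside J \<inter> outside J = {}" "inside J \<union> outside J = - J"
    "frontier (inside J) = J" "frontier (outside J) = J"
    "inside J \<in> components (- J)" "outside J \<in> components (- J)"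
proof -
  obtain v where "v \<in> S" using pents_subset_verts(2)[OF simple S] by fastforce
  then obtain x where x: "x \<in> edges G" "x \<subseteq> S" using pent_has_edge[OF S] by metis
  obtain q where q: "arc q" "pathstart q = pathfinish (\<gamma> x)" "pathfinish q = pathstart (\<gamma> x)"
    "curve S = path_image (\<gamma> x) \<union> path_image q" "path_image q \<inter> oarc (\<gamma> x) = {}"
    using pent_edge_arc[OF S x] by metis
  note jj = jordan_arc_pair[OF edge_arc[OF x(1)] q(1,2,3,5), folded q(4), folded J_def]
  show "inside J \<inter> outside J = {}" "inside J \<union> outside J = - J"
    "frontier (inside J) = J" "frontier (outside J) = J"
    "inside J \<in> components (- J)" "outside J \<in> components (- J)" by (rule jj)+
qed

lemma vertex_curve_iff:
  assumes S: "S \<in> pents G" and v: "v \<in> verts G" shows "p v \<in> curve S \<longleftrightarrow> v \<in> S"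
proof
  assume "p v \<in> curve S"
  then show "v \<in> S" unfolding curve_def using vertex_on_edge v by blast
next
  assume "v \<in> S"
  then obtain x where x: "x \<in> edges G" "x \<subseteq> S" "v \<in> x" using pent_has_edge[OF S] by metis
  then have "p v \<in> path_image (\<gamma> x)" using edge_ends_image by blast
  then show "p v \<in> curve S" unfolding curve_def using x by blast
qed

lemma oarc_curve_disjoint:
  assumes S: "S \<in> pents G" and x: "x \<in> edges G" "\<not> x \<subseteq> S"
  shows "oarc (\<gamma> x) \<inter> curve S = {}"
proof -
  have "oarc (\<gamma> x) \<inter> path_image (\<gamma> y) = {}" if "y \<in> edges G" "y \<subseteq> S" for y
    using oarc_disjoint[OF x(1) that(1)] that(2) x(2) by blast
  then show ?thesis unfolding curve_def by blast
qed

section \<open>The two sides of a five-cycle\<close>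

definition inner_verts :: "'a set \<Rightarrow> 'a set" where
  "inner_verts S = {v\<in>verts G. p v \<in> inside (curve S)}"

definition outer_verts :: "'a set \<Rightarrow> 'a set" where
  "outer_verts S = {v\<in>verts G. p v \<in> outside (curve S)}"

lemma inner_outer:
  assumes S: "S \<in> pents G"
  shows "verts G = S \<union> inner_verts S \<union> outer_verts S" "inner_verts S \<inter> S = {}" "outer_verts S \<inter> S = {}" "inner_verts S \<inter> outer_verts S = {}"
proof -
  note jj = curve_jordan[OF S] and SV = pents_subset_verts(1)[OF simple S]
  have *: "v \<in> S \<longleftrightarrow> p v \<notin> inside (curve S) \<and> p v \<notin> outside (curve S)" if "v \<in> verts G" for v
    using vertex_curve_iff[OF S that] jj(2) by blast
  show "verts G = S \<union> inner_verts S \<union> outer_verts S" unfolding inner_verts_def outer_verts_def using * SV by blast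
  show "inner_verts S \<inter> S = {}" "outer_verts S \<inter> S = {}" unfolding inner_verts_def outer_verts_def using * SV by blast+
  show "inner_verts S \<inter> outer_verts S = {}" unfolding inner_verts_def outer_verts_def using jj(1) by blast
qed

text \<open>Such an edge is not contained in S, so its interior misses the curve; its ends miss it
  as well. Being connected, the whole edge stays on one side.\<close>

lemma no_edge_inner_outer:
  assumes S: "S \<in> pents G" and uv: "u \<in> inner_verts S" "v \<in> outer_verts S" shows "{u, v} \<notin> edges G"
proof
  assume x: "{u, v} \<in> edges G"
  let ?J = "curve S" and ?g = "\<gamma> {u, v}"
  note jj = curve_jordan[OF S]
  have uv': "u \<notin> S" "v \<notin> S" using uv inner_outer(2,3)[OF S] by blast+
  have pu: "p u \<in> inside ?J" "p v \<in> outside ?J" using uv by (simp_all add: inner_verts_def outer_verts_def)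
  have im: "p u \<in> path_image ?g" "p v \<in> path_image ?g" using edge_ends_image[OF x] by simp_all
  have nn: "p u \<notin> ?J" "p v \<notin> ?J"
    using pu inside_no_overlap[of ?J] outside_no_overlap[of ?J] by blast+
  have "oarc ?g \<inter> ?J = {}" using oarc_curve_disjoint[OF S x] uv' by simp
  then have dj: "path_image ?g \<subseteq> - ?J"
    using nn unfolding edge_oarc[OF x] by auto
  have "path_image ?g \<subseteq> inside ?J"
    by (rule components_maximal[OF jj(5) _ dj])
       (use connected_arc_image[OF edge_arc[OF x]] pu im in auto)
  then show False using im(2) pu(2) jj(1) by blast
qed

text \<open>If one side of the curve contains no vertex, then, a pentagon having no chord, that side is a face.\<close>

lemma empty_side_is_face:
  assumes S: "S \<in> pents G" and F: "F \<subseteq> edges G" "{x\<in>edges G. x \<subseteq> S} \<subseteq> F"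
    and X: "X \<in> components (- curve S)" "frontier X = curve S" "X \<inter> p ` verts G = {}"
  shows "X \<in> components (- drawn F)" "{v\<in>verts G. p v \<in> closure X} = S" "card (incident F X) \<ge> 5"
proof -
  let ?J = "curve S"
  have cl: "closure X = X \<union> ?J" using X(2) closure_Un_frontier[of X] by simp
  have XJ: "X \<subseteq> - ?J" using X(1) by (rule in_components_subset)
  have "X \<inter> path_image (\<gamma> x) = {}" if x: "x \<in> F" for x
  proof (cases "x \<subseteq> S")
    case True
    then have "path_image (\<gamma> x) \<subseteq> ?J" unfolding curve_def using x F(1) by blast
    then show ?thesis using XJ by blast
  next
    case False
    have xE: "x \<in> edges G" using x F by blast
    have dj: "oarc (\<gamma> x) \<inter> ?J = {}" by (rule oarc_curve_disjoint[OF S xE False])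
    \<comment> \<open>An edge entering X would stay in it and end on its boundary, as X contains no
      vertex. Both its ends would then belong to S, contrary to the case assumption.\<close>
    have "oarc (\<gamma> x) \<inter> X = {}"
    proof (rule ccontr)
      assume "oarc (\<gamma> x) \<inter> X \<noteq> {}"
      then have "oarc (\<gamma> x) \<subseteq> X"
        using components_maximal[OF X(1) connected_oarc[OF edge_arc[OF xE]]] dj by blast
      then have "closure (oarc (\<gamma> x)) \<subseteq> closure X" by (rule closure_mono)
      then have "path_image (\<gamma> x) \<subseteq> X \<union> ?J"
        using path_image_subset_closure_oarc[OF edge_arc[OF xE]] cl by blast
      then have "p ` x \<subseteq> X \<union> ?J" using edge_ends_image[OF xE] by blast
      then have "p ` x \<subseteq> ?J" using X(3) edge_subset_verts[OF xE] by blast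
      then have "x \<subseteq> S" using vertex_curve_iff[OF S] edge_subset_verts[OF xE] by blast
      then show False using False by simp
    qed
    moreover have "p ` x \<inter> X = {}" using X(3) edge_subset_verts[OF xE] by blast
    ultimately show ?thesis using edge_oarc[OF xE] by blast
  qed
  then have XK: "X \<subseteq> - drawn F" unfolding drawn_def using X(3) by blast
  have JK: "- drawn F \<subseteq> - ?J" unfolding drawn_def curve_def using F(2) by blast
  show "X \<in> components (- drawn F)" by (rule components_intermediate_subset[OF X(1) XK JK])
  show "{v\<in>verts G. p v \<in> closure X} = S"
    unfolding cl using X(3) vertex_curve_iff[OF S] pents_subset_verts(1)[OF simple S] by blast
  obtain a b c d e where pen: "pentagon G a b c d e" and S': "S = {a, b, c, d, e}"
    using S by (rule pentsE)
  have ES: "{x\<in>edges G. x \<subseteq> S} = {{a, b}, {b, c}, {c, d}, {d, e}, {e, a}}"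
    unfolding S' by (rule pentagon_induced[OF simple C4 pen])
  have "card {x\<in>edges G. x \<subseteq> S} = 5" unfolding ES using pen
    by (auto simp: pentagon_def doubleton_eq_iff card_insert_if)
  moreover have "{x\<in>edges G. x \<subseteq> S} \<subseteq> incident F X"
  proof
    fix x assume x: "x \<in> {x\<in>edges G. x \<subseteq> S}"
    then have "path_image (\<gamma> x) \<subseteq> ?J" unfolding curve_def by blast
    then have "oarc (\<gamma> x) \<subseteq> closure X" using oarc_subset[of "\<gamma> x"] cl by blast
    then have "closure X \<inter> oarc (\<gamma> x) \<noteq> {}" using oarc_nonempty[OF edge_arc, of x] x by blast
    then show "x \<in> incident F X" unfolding incident_def using x F(2) by blast
  qed
  moreover have "finite (incident F X)"
    using finite_subset[OF F(1) finite_E] unfolding incident_def by simp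
  ultimately show "card (incident F X) \<ge> 5" by (metis card_mono)
qed

lemma card_pents_nonseparating:
  assumes ne: "pents G \<noteq> {}" and nonsep: "\<And>S. S \<in> pents G \<Longrightarrow> inner_verts S = {} \<or> outer_verts S = {}"
  shows "3 * card (pents G) + 4 \<le> 2 * card (verts G)"
proof -
  \<comment> \<open>Each drawn edge lies on a five-cycle, the other four edges of which supply the
    return arc for \<open>on_cycle\<close>.\<close>
  define F where "F = {x\<in>edges G. \<exists>S\<in>pents G. x \<subseteq> S}"
  have F: "F \<subseteq> edges G" by (auto simp: F_def)
  have FS: "{x\<in>edges G. x \<subseteq> S} \<subseteq> F" if "S \<in> pents G" for S using that by (auto simp: F_def)
  \<comment> \<open>If both sides are free of vertices, only the inside is taken: one face per
    five-cycle.\<close>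
  define \<Phi> where "\<Phi> S = (if inner_verts S = {} then inside (curve S) else outside (curve S))" for S
  have \<Phi>: "\<Phi> S \<in> components (- drawn F)" "{v\<in>verts G. p v \<in> closure (\<Phi> S)} = S"
    "card (incident F (\<Phi> S)) \<ge> 5" if S: "S \<in> pents G" for S
  proof -
    note jj = curve_jordan[OF S]
    have "\<Phi> S \<in> components (- curve S)" "frontier (\<Phi> S) = curve S"
      using jj by (simp_all add: \<Phi>_def)
    moreover have "\<Phi> S \<inter> p ` verts G = {}"
    proof (cases "inner_verts S = {}")
      case True then show ?thesis unfolding \<Phi>_def inner_verts_def by auto
    next
      case False
      then have "outer_verts S = {}" using nonsep[OF S] by simp
      then show ?thesis using False unfolding \<Phi>_def outer_verts_def by auto
    qed
    ultimately show "\<Phi> S \<in> components (- drawn F)" "{v\<in>verts G. p v \<in> closure (\<Phi> S)} = S"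
      "card (incident F (\<Phi> S)) \<ge> 5" using empty_side_is_face[OF S F FS[OF S]] by blast+
  qed
  \<comment> \<open>The face determines its five-cycle: S consists of the vertices in the closure of
    the face.\<close>
  have inj: "inj_on \<Phi> (pents G)" by (rule inj_onI) (metis \<Phi>(2))
  obtain S where S: "S \<in> pents G" using ne by blast
  have finF: "finite F" using finite_subset[OF F finite_E] .
  have "incident F (\<Phi> S) \<subseteq> F" by (auto simp: incident_def)
  then have "card (incident F (\<Phi> S)) \<le> card F" by (rule card_mono[OF finF])
  then have cF: "card F \<ge> 2" using \<Phi>(3)[OF S] by linarith
  have "S \<noteq> {}" using pents_subset_verts(2)[OF simple S] by auto
  then have nP: "p ` verts G \<noteq> {}" using pents_subset_verts(1)[OF simple S] by auto
  have cyc: "on_cycle F x" if x: "x \<in> F" for x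
  proof -
    obtain T where T: "T \<in> pents G" "x \<subseteq> T" and xE: "x \<in> edges G" using x by (auto simp: F_def)
    obtain q where q: "arc q" "pathstart q = pathfinish (\<gamma> x)" "pathfinish q = pathstart (\<gamma> x)"
      "path_image q = (\<Union>y\<in>{y\<in>edges G. y \<subseteq> T} - {x}. path_image (\<gamma> y))"
      by (rule pent_edge_arc[OF T(1) xE T(2)])
    have "path_image q \<subseteq> drawn (F - {x})"
      unfolding q(4) drawn_def using FS[OF T(1)] by blast
    then show ?thesis unfolding on_cycle_def using q by blast
  qed
  have "3 * card (\<Phi> ` pents G) + 4 \<le> 2 * card (p ` verts G)"
    by (rule card_pentagonal_faces[OF F nP cF cyc])
       (use \<Phi> finite_pents[OF simple] in auto)
  then show ?thesis using card_image[OF inj] card_image[OF inj_p] by simp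
qed

end

section \<open>Induction along separating five-cycles\<close>

lemma card_pents_le:
  assumes "simple_graph G" "planar G" "C4_free G" "card (verts G) \<ge> 4"
  shows "card (pents G) + 4 \<le> card (verts G)"
  using assms
proof (induction "card (verts G)" arbitrary: G rule: less_induct)
  case (less G)
  note G = less.prems
  obtain p \<gamma> where "plane_drawing G p \<gamma>" using G(2) by (auto simp: planar_def)
  then interpret plane_graph G p \<gamma> using G by unfold_locales
  have finV: "finite (verts G)" using G(1) by (simp add: simple_graph_def)
  note sub = pents_subset_verts[OF G(1)]
  show ?case
  proof (cases "pents G = {}")
    case True
    then show ?thesis using G(4) by simp
  next
    case ne: False
    show ?thesis
    proof (cases "\<forall>S\<in>pents G. inner_verts S = {} \<or> outer_verts S = {}")
      case True
      then have le: "3 * card (pents G) + 4 \<le> 2 * card (verts G)"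
        using card_pents_nonseparating[OF ne] by blast
      obtain S where S: "S \<in> pents G" using ne by blast
      then have "card (verts G) \<ge> 5" using sub[OF S] card_mono[OF finV] by metis
      \<comment> \<open>For five vertices the face count would still allow two five-cycles. From six
        vertices on it gives the bound.\<close>
      moreover have "card (pents G) \<le> 1" if n5: "card (verts G) = 5"
      proof -
        have "T = verts G" if "T \<in> pents G" for T
          using sub[OF that] card_subset_eq[OF finV] n5 by simp
        then have "pents G \<subseteq> {verts G}" by blast
        then show ?thesis using card_mono[of "{verts G}" "pents G"] by simp
      qed
      ultimately show ?thesis using le by linarith
    next
      case False
      then obtain S where S: "S \<in> pents G" and AB: "inner_verts S \<noteq> {}" "outer_verts S \<noteq> {}" by blast
      note io = inner_outer[OF S]
      let ?A = "inner_verts S" and ?B = "outer_verts S"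
      have finA: "finite ?A" "finite ?B" "finite S" using io(1) finV by (metis finite_Un)+
      have cA: "card (S \<union> ?A) = 5 + card ?A" and cB: "card (S \<union> ?B) = 5 + card ?B"
        using card_Un_disjoint[of S ?A] card_Un_disjoint[of S ?B] finA io(2,3) sub(2)[OF S]
        by (simp_all add: Int_commute)
      have "(S \<union> ?A) \<inter> ?B = {}" using io by blast
      then have cV: "card (verts G) = 5 + card ?A + card ?B"
        using card_Un_disjoint[of "S \<union> ?A" ?B] finA cA io(1) by simp
      have pos: "card ?A > 0" "card ?B > 0" using AB finA by (simp_all add: card_gt_0_iff)
      have part: "card {T\<in>pents G. T \<subseteq> W} + 4 \<le> card W"
        if W: "W \<subseteq> verts G" "card W < card (verts G)" "card W \<ge> 4" for W
        using less.hyps[of "induce G W"] W simple_graph_induce[OF G(1) W(1)] planar_induce[OF G(2) W(1)]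
          C4_free_induce[OF G(3), of W] pents_induce[of G W] by (simp add: induce_def)
      let ?P = "{T\<in>pents G. T \<subseteq> S \<union> ?A}" and ?Q = "{T\<in>pents G. T \<subseteq> S \<union> ?B}"
      have p1: "card ?P + 4 \<le> 5 + card ?A" "card ?Q + 4 \<le> 5 + card ?B"
        using part[of "S \<union> ?A"] part[of "S \<union> ?B"] io(1) cA cB cV pos by auto
      have fin: "finite ?P" "finite ?Q" using finite_pents[OF G(1)] by auto
      have "pents G \<subseteq> ?P \<union> ?Q"
        using pents_noncrossing[OF G(1,3) S _ io no_edge_inner_outer[OF S]] by blast
      then have "card (pents G) \<le> card (?P \<union> ?Q)" using fin by (intro card_mono) auto
      moreover have "card (?P \<union> ?Q) + card (?P \<inter> ?Q) = card ?P + card ?Q"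
        using card_Un_Int[OF fin] by simp
      \<comment> \<open>S is counted in both parts. This one unit turns the sum
        \<open>card ?A + 1 + (card ?B + 1)\<close> of the bounds into exactly
        \<open>card (verts G) - 4\<close>.\<close>
      moreover have "card (?P \<inter> ?Q) \<ge> 1"
      proof -
        have "S \<in> ?P \<inter> ?Q" using S by blast
        then have "card {S} \<le> card (?P \<inter> ?Q)" using fin by (intro card_mono) auto
        then show ?thesis by simp
      qed
      ultimately show ?thesis using p1 cV by linarith
    qed
  qed
qed

section \<open>The extremal graphs\<close>

definition hub0 :: "nat set" where
  "hub0 = {w. w = 2 \<or> w = 3 \<or> 6 \<le> w \<and> (w mod 4 = 1 \<or> w mod 4 = 2)}"

definition hub1 :: "nat set" where
  "hub1 = {w. w = 2 \<or> w = 4 \<or> 6 < w \<and> (w mod 4 = 3 \<or> w mod 4 = 0)}"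

text \<open>The extremal graphs are induced subgraphs of one infinite graph: the path 3, 4, 5, \<dots> whose
  vertices are joined to the two hubs 0 and 1 in the pattern 0, 1, none, 0, 1, 1, 0, 0, 1, 1, \<dots>,
  and the vertex 2 joined to both hubs.\<close>

definition ladder :: "nat sgraph" where
  "ladder = \<lparr>verts = UNIV, edges = {{0, w} | w. w \<in> hub0} \<union> {{1, w} | w. w \<in> hub1} \<union> {{w, w + 1} | w. 3 \<le> w}\<rparr>"

lemma hub_ge_2: "w \<in> hub0 \<Longrightarrow> 2 \<le> w" "w \<in> hub1 \<Longrightarrow> 2 \<le> w"
  by (auto simp: hub0_def hub1_def)

lemma hub_small [simp]: "0 \<notin> hub0" "Suc 0 \<notin> hub0" "0 \<notin> hub1" "Suc 0 \<notin> hub1"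
  by (auto simp: hub0_def hub1_def)

lemma ladder_edge_cases:
  assumes "{u, v} \<in> edges ladder" "u < v"
  obtains "u = 0" "v \<in> hub0" | "u = 1" "v \<in> hub1" | "3 \<le> u" "v = u + 1"
  using assms hub_ge_2 unfolding ladder_def by (fastforce simp: doubleton_eq_iff)

lemma ladder_edgeE:
  assumes "x \<in> edges ladder"
  obtains u v where "x = {u, v}" "u < v"
proof -
  from assms consider w where "x = {0, w}" "w \<in> hub0" | w where "x = {1, w}" "w \<in> hub1"
    | w where "x = {w, w + 1}" unfolding ladder_def by auto
  then show ?thesis
  proof cases
    case 1 then show ?thesis using that[of 0 w] hub_ge_2 by force
  next
    case 2 then show ?thesis using that[of 1 w] hub_ge_2 by force
  next
    case 3 then show ?thesis using that[of w "w + 1"] by simp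
  qed
qed

lemma ladder_hub0: "{0, w} \<in> edges ladder \<longleftrightarrow> w \<in> hub0"
  using hub_ge_2 unfolding ladder_def by (auto simp: doubleton_eq_iff)

lemma ladder_hub1: "{1, w} \<in> edges ladder \<longleftrightarrow> w \<in> hub1"
  using hub_ge_2 unfolding ladder_def by (auto simp: doubleton_eq_iff)

lemma ladder_rail:
  assumes "2 \<le> u" "2 \<le> v" "{u, v} \<in> edges ladder"
  shows "3 \<le> u \<and> 3 \<le> v \<and> (v = u + 1 \<or> u = v + 1)"
proof -
  consider w where "{u, v} = {0, w}" | w where "{u, v} = {1, w}"
    | w where "{u, v} = {w, w + 1}" "3 \<le> w" using assms(3) unfolding ladder_def by auto
  then show ?thesis using assms(1,2) by cases (auto simp: doubleton_eq_iff)
qed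

lemma hub0_gap: "3 \<le> w \<Longrightarrow> w \<in> hub0 \<Longrightarrow> w + 2 \<notin> hub0"
  unfolding hub0_def mem_Collect_eq by presburger

text \<open>Path vertices at distance two on a common hub would give a four-cycle. The restriction
  to path vertices matters: 2 and 4 both belong to \<open>hub1\<close>.\<close>

lemma hub1_gap: "3 \<le> w \<Longrightarrow> w \<in> hub1 \<Longrightarrow> w + 2 \<notin> hub1"
  unfolding hub1_def mem_Collect_eq by presburger

lemma hub0_hub1: "w \<in> hub0 \<Longrightarrow> w \<in> hub1 \<Longrightarrow> w = 2"
  unfolding hub0_def hub1_def mem_Collect_eq by presburger

lemma rails_common_neighbour:
  assumes "2 \<le> b" "2 \<le> d" "2 \<le> c" "b \<noteq> d" "{b, c} \<in> edges ladder" "{c, d} \<in> edges ladder"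
  shows "3 \<le> b \<and> 3 \<le> d \<and> (d = b + 2 \<or> b = d + 2)"
  using ladder_rail[OF assms(1,3,5)] ladder_rail[OF assms(3,2,6)] assms(4) by auto

text \<open>The corners next to the hub a lie outside both hubs. If the opposite corner is no hub,
  they are path vertices at distance two attached to the same hub; if it is the other hub, both of
  them are the only common neighbour 2.\<close>

lemma no_hub_C4:
  assumes h: "a = 0 \<or> a = 1"
    and E: "{a, b} \<in> edges ladder" "{b, c} \<in> edges ladder" "{c, d} \<in> edges ladder" "{d, a} \<in> edges ladder"
    and dis: "distinct [a, b, c, d]"
  shows False
proof -
  have E': "{a, d} \<in> edges ladder" "{c, b} \<in> edges ladder" using E by (simp_all add: insert_commute)
  have bd: "2 \<le> b" "2 \<le> d" using h E(1) E'(1) hub_ge_2 ladder_hub0 ladder_hub1 by metis+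
  show False
  proof (cases "2 \<le> c")
    case True
    have "3 \<le> b \<and> 3 \<le> d \<and> (d = b + 2 \<or> b = d + 2)"
      using rails_common_neighbour[OF bd True _ E(2,3)] dis by simp
    then show False using h E(1) E'(1) ladder_hub0 ladder_hub1 hub0_gap hub1_gap by metis
  next
    case False
    then have "c = 0 \<or> c = 1" by auto
    then have "b = 2" "d = 2"
      using h dis E(1,3) E' ladder_hub0 ladder_hub1 hub0_hub1 by auto
    then show False using dis by simp
  qed
qed

lemma C4_free_ladder: "C4_free ladder"
  unfolding C4_free_def
proof (intro notI, elim exE conjE)
  fix a b c d
  assume dis: "distinct [a, b, c, d]" and E: "{a, b} \<in> edges ladder" "{b, c} \<in> edges ladder"
    "{c, d} \<in> edges ladder" "{d, a} \<in> edges ladder"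
  have dis': "distinct [b, c, d, a]" "distinct [c, d, a, b]" "distinct [d, a, b, c]" using dis by auto
  have "\<not> (a = 0 \<or> a = 1)" using no_hub_C4[OF _ E dis] by blast
  moreover have "\<not> (b = 0 \<or> b = 1)" using no_hub_C4[OF _ E(2,3,4,1) dis'(1)] by blast
  moreover have "\<not> (c = 0 \<or> c = 1)" using no_hub_C4[OF _ E(3,4,1,2) dis'(2)] by blast
  moreover have "\<not> (d = 0 \<or> d = 1)" using no_hub_C4[OF _ E(4,1,2,3) dis'(3)] by blast
  ultimately have ge: "2 \<le> a" "2 \<le> b" "2 \<le> c" "2 \<le> d" by auto
  have r: "b = a + 1 \<or> a = b + 1" "c = b + 1 \<or> b = c + 1" "d = c + 1 \<or> c = d + 1" "a = d + 1 \<or> d = a + 1"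
    by (rule ladder_rail[OF ge(1,2) E(1), THEN conjunct2, THEN conjunct2]
          ladder_rail[OF ge(2,3) E(2), THEN conjunct2, THEN conjunct2]
          ladder_rail[OF ge(3,4) E(3), THEN conjunct2, THEN conjunct2]
          ladder_rail[OF ge(4,1) E(4), THEN conjunct2, THEN conjunct2])+
  have ne: "a \<noteq> c" "b \<noteq> d" using dis by simp_all
  \<comment> \<open>What remains would be a four-cycle on the path alone, where b and d are both the
    midpoint of a and c.\<close>
  have ac: "c = a + 2 \<or> a = c + 2" using r(1,2) ne(1) by linarith
  then have "b + b = a + c" using r(1,2) by linarith
  moreover have "d + d = a + c" using ac r(3,4) by linarith
  ultimately show False using ne(2) by simp
qed

lemma simple_graph_ladder:
  assumes "finite V" shows "simple_graph (induce ladder V)"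
proof -
  have "\<exists>u\<in>V. \<exists>v\<in>V. u \<noteq> v \<and> x = {u, v}" if x: "x \<in> edges ladder" "x \<subseteq> V" for x
  proof -
    obtain u v where "x = {u, v}" "u < v" using ladder_edgeE[OF x(1)] .
    then show ?thesis using x(2) by (intro bexI[of _ u] bexI[of _ v]) auto
  qed
  then show ?thesis unfolding simple_graph_def induce_def using assms by simp
qed

text \<open>The path lies on the real axis, the hubs above and below the vertex 2 on its left.\<close>

definition ladder_pos :: "nat \<Rightarrow> complex" where
  "ladder_pos w = (if w = 0 then Complex (-1) 1 else if w = 1 then Complex (-1) (-1) else Complex (real w - 3) 0)"

text \<open>Edges are unordered, so the smaller vertex serves as the start of the segment; on a
  spoke this is the hub.\<close>

definition ladder_seg :: "nat set \<Rightarrow> real \<Rightarrow> complex" where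
  "ladder_seg x = linepath (ladder_pos (Min x)) (ladder_pos (Max x))"

text \<open>Recovers an edge of the straight-line drawing from any interior point of its segment.\<close>

definition edge_at :: "complex \<Rightarrow> nat set" where
  "edge_at z = (if Im z \<noteq> 0
     then {if Im z > 0 then 0 else 1, nat \<lfloor>(Re z + 1) / (1 - \<bar>Im z\<bar>)\<rfloor> + 2}
     else {nat \<lfloor>Re z\<rfloor> + 3, nat \<lfloor>Re z\<rfloor> + 4})"

section \<open>The straight-line drawing\<close>

lemma inj_ladder_pos: "inj ladder_pos"
  by (rule injI) (auto simp: ladder_pos_def split: if_splits)

lemma ladder_seg_eq: "u < v \<Longrightarrow> ladder_seg {u, v} = linepath (ladder_pos u) (ladder_pos v)"
  by (simp add: ladder_seg_def)

lemma open_segment_edge_at: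
  assumes "{u, v} \<in> edges ladder" "u < v" "z \<in> open_segment (ladder_pos u) (ladder_pos v)"
  shows "edge_at z = {u, v}" "z \<notin> range ladder_pos"
proof -
  obtain t where t: "0 < t" "t < 1" and z: "z = (1 - t) *\<^sub>R ladder_pos u + t *\<^sub>R ladder_pos v"
    using assms(3) by (auto simp: in_segment)
  have "edge_at z = {u, v} \<and> z \<notin> range ladder_pos"
    using assms(1,2)
  proof (cases rule: ladder_edge_cases)
    case 1
    have v: "2 \<le> v" using 1 hub_ge_2 by simp
    then have Rz: "Re z + 1 = t * (real v - 2)" and Iz: "Im z = 1 - t"
      unfolding z using 1 by (simp_all add: ladder_pos_def algebra_simps)
    \<comment> \<open>This quotient is constant along a segment from the hub: it is the distance
      from the position of 2 to the point where the segment reaches the real axis.\<close>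
    have "(Re z + 1) / (1 - \<bar>Im z\<bar>) = real_of_int (int v - 2)"
      unfolding Rz Iz using t by simp
    then have "nat \<lfloor>(Re z + 1) / (1 - \<bar>Im z\<bar>)\<rfloor> + 2 = v" using v by (simp only: floor_of_int)
    then have "edge_at z = {u, v}" unfolding edge_at_def using Iz t 1 by simp
    moreover have "z \<notin> range ladder_pos" using Iz t by (auto simp: ladder_pos_def split: if_splits)
    ultimately show ?thesis by simp
  next
    case 2
    have v: "2 \<le> v" using 2 hub_ge_2 by simp
    then have Rz: "Re z + 1 = t * (real v - 2)" and Iz: "Im z = t - 1"
      unfolding z using 2 by (simp_all add: ladder_pos_def algebra_simps)
    have "(Re z + 1) / (1 - \<bar>Im z\<bar>) = real_of_int (int v - 2)"
      unfolding Rz Iz using t by simp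
    then have "nat \<lfloor>(Re z + 1) / (1 - \<bar>Im z\<bar>)\<rfloor> + 2 = v" using v by (simp only: floor_of_int)
    then have "edge_at z = {u, v}" unfolding edge_at_def using Iz t 2 by simp
    moreover have "z \<notin> range ladder_pos" using Iz t by (auto simp: ladder_pos_def split: if_splits)
    ultimately show ?thesis by simp
  next
    case 3
    then have Rz: "Re z = real_of_int (int u - 3) + t" and Iz: "Im z = 0"
      unfolding z by (simp_all add: ladder_pos_def algebra_simps)
    have fl: "\<lfloor>Re z\<rfloor> = int u - 3" unfolding Rz using t by (simp add: floor_eq_iff)
    then have "edge_at z = {u, v}" unfolding edge_at_def using Iz 3 by (simp add: nat_diff_distrib')
    moreover have "z \<notin> range ladder_pos"
    proof
      assume "z \<in> range ladder_pos"
      then obtain k where k: "z = ladder_pos k" by auto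
      then have "Re z = real_of_int (int k - 3)" using Iz by (auto simp: ladder_pos_def split: if_splits)
      then have "Re z = real_of_int \<lfloor>Re z\<rfloor>" by (simp only: floor_of_int)
      then show False unfolding fl using Rz t(1) by linarith
    qed
    ultimately show ?thesis by simp
  qed
  then show "edge_at z = {u, v}" "z \<notin> range ladder_pos" by simp_all
qed

text \<open>Since an edge can be read off from any of its interior points, two edges sharing such a
  point coincide. This replaces a comparison of all kinds of pairs of edges.\<close>

lemma planar_ladder: "planar (induce ladder V)"
proof -
  have ladder_seg: "arc (ladder_seg x)" "{pathstart (ladder_seg x), pathfinish (ladder_seg x)} = ladder_pos ` x"
    "\<And>z. z \<in> path_image (ladder_seg x) - ladder_pos ` x \<Longrightarrow> edge_at z = x \<and> z \<notin> range ladder_pos"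
    if x: "x \<in> edges ladder" for x
  proof -
    obtain u v where uv: "x = {u, v}" "u < v" using ladder_edgeE[OF x] .
    have s: "ladder_seg x = linepath (ladder_pos u) (ladder_pos v)" unfolding uv(1) using uv(2) by (rule ladder_seg_eq)
    have "ladder_pos u \<noteq> ladder_pos v" using inj_ladder_pos uv(2) by (simp add: inj_eq)
    then show "arc (ladder_seg x)" unfolding s by (rule arc_linepath)
    show "{pathstart (ladder_seg x), pathfinish (ladder_seg x)} = ladder_pos ` x" unfolding s by (simp add: uv(1))
    fix z assume "z \<in> path_image (ladder_seg x) - ladder_pos ` x"
    then have "z \<in> open_segment (ladder_pos u) (ladder_pos v)"
      unfolding s by (simp add: open_segment_def uv(1))
    then show "edge_at z = x \<and> z \<notin> range ladder_pos"
      using open_segment_edge_at[of u v z] x uv by simp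
  qed
  have "plane_drawing (induce ladder V) ladder_pos ladder_seg"
    unfolding plane_drawing_def induce_def sgraph.simps
  proof (intro conjI ballI impI)
    show "inj_on ladder_pos V" using inj_ladder_pos inj_on_subset by blast
    fix x assume "x \<in> {x\<in>edges ladder. x \<subseteq> V}"
    then have x: "x \<in> edges ladder" by simp
    show "arc (ladder_seg x)" "{pathstart (ladder_seg x), pathfinish (ladder_seg x)} = ladder_pos ` x" using ladder_seg(1,2)[OF x] by simp_all
    show "(path_image (ladder_seg x) - ladder_pos ` x) \<inter> ladder_pos ` V = {}" using ladder_seg(3)[OF x] by blast
    fix y assume "y \<in> {x\<in>edges ladder. x \<subseteq> V}" and ne: "x \<noteq> y"
    then have y: "y \<in> edges ladder" by simp
    have "z \<notin> path_image (ladder_seg y)" if z: "z \<in> path_image (ladder_seg x) - ladder_pos ` x" for z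
    proof
      assume zy: "z \<in> path_image (ladder_seg y)"
      have "edge_at z = x" "z \<notin> range ladder_pos" using ladder_seg(3)[OF x z] by simp_all
      moreover from this(2) have "edge_at z = y" using ladder_seg(3)[OF y, of z] zy by blast
      ultimately show False using ne by simp
    qed
    then show "(path_image (ladder_seg x) - ladder_pos ` x) \<inter> path_image (ladder_seg y) = {}" by blast
  qed
  then show ?thesis unfolding planar_def by blast
qed

text \<open>Consecutive path vertices with different hubs close up through the vertex 2; four consecutive
  path vertices whose ends have the same hub close up through that hub.\<close>

definition ladder_pent :: "nat \<Rightarrow> nat set" where
  "ladder_pent w = (if w = 3 \<or> 6 \<le> w \<and> even w then {0, 1, 2, w, w + 1}
     else {if w - 1 \<in> hub0 then 0 else 1, w - 1, w, w + 1, w + 2})"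

text \<open>From 7 on, the pairs with a common hub start at odd vertices. For even k, therefore, k +
  1 opens the next pair and k + 3 the one after it, which is back at the hub of k.\<close>

lemma hub_pattern:
  assumes k: "6 \<le> k" "even k"
  shows "k \<in> hub0 \<and> k + 1 \<in> hub1 \<and> k + 3 \<in> hub0 \<or> k \<notin> hub0 \<and> k \<in> hub1 \<and> k + 1 \<in> hub0 \<and> k + 3 \<in> hub1"
proof -
  have "k mod 4 = 0 \<or> k mod 4 = 2" using k(2) by presburger
  then show ?thesis
  proof
    assume m: "k mod 4 = 0"
    then have "k \<noteq> 6" "(k + 1) mod 4 = 1" "(k + 3) mod 4 = 3" by presburger+
    then show ?thesis using k m unfolding hub0_def hub1_def by simp
  next
    assume m: "k mod 4 = 2"
    then have "(k + 1) mod 4 = 3" "(k + 3) mod 4 = 1" by presburger+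
    then show ?thesis using k m unfolding hub0_def hub1_def by simp
  qed
qed

lemma ladder_pent_in_pents:
  assumes w: "3 \<le> w" shows "ladder_pent w \<in> pents ladder"
proof -
  have rail: "{k, k + 1} \<in> edges ladder" if "3 \<le> k" for k using that unfolding ladder_def by auto
  have spoke0: "{0, k} \<in> edges ladder" "{k, 0} \<in> edges ladder" if "k \<in> hub0" for k
    using that ladder_hub0[of k] insert_commute[of k 0 "{}"] by simp_all
  have spoke1: "{1, k} \<in> edges ladder" "{k, 1} \<in> edges ladder" if "k \<in> hub1" for k
    using that ladder_hub1[of k] insert_commute[of k 1 "{}"] by simp_all
  have two: "2 \<in> hub0" "2 \<in> hub1" by (simp_all add: hub0_def hub1_def)
  show ?thesis
  proof (cases "w = 3 \<or> 6 \<le> w \<and> even w")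
    case True
    then have "w \<in> hub0 \<and> w + 1 \<in> hub1 \<or> w \<in> hub1 \<and> w + 1 \<in> hub0"
    proof
      assume "w = 3" then show ?thesis by (simp add: hub0_def hub1_def)
    next
      assume "6 \<le> w \<and> even w" then show ?thesis using hub_pattern[of w] by blast
    qed
    then show ?thesis
    proof
      assume a: "w \<in> hub0 \<and> w + 1 \<in> hub1"
      have "pentagon ladder 0 w (w + 1) 1 2"
        unfolding pentagon_def using a w rail[OF w] spoke0 spoke1 two by simp
      moreover have "{0, w, w + 1, 1, 2} = ladder_pent w" unfolding ladder_pent_def using True by auto
      ultimately show ?thesis using pentsI by metis
    next
      assume a: "w \<in> hub1 \<and> w + 1 \<in> hub0"
      have "pentagon ladder 1 w (w + 1) 0 2"
        unfolding pentagon_def using a w rail[OF w] spoke0 spoke1 two by simp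
      moreover have "{1, w, w + 1, 0, 2} = ladder_pent w" unfolding ladder_pent_def using True by auto
      ultimately show ?thesis using pentsI by metis
    qed
  next
    case False
    then have w4: "4 \<le> w" using w by auto
    define h where "h = (if w - 1 \<in> hub0 then 0 else 1 :: nat)"
    have "w - 1 \<in> hub0 \<and> w + 2 \<in> hub0 \<or> w - 1 \<notin> hub0 \<and> w - 1 \<in> hub1 \<and> w + 2 \<in> hub1"
    proof (cases "w = 4 \<or> w = 5")
      case True then show ?thesis by (auto simp: hub0_def hub1_def)
    next
      case w45: False
      \<comment> \<open>Beyond the irregular start the remaining w are odd, so the path of four
        vertices starts at an even one.\<close>
      then have "6 \<le> w - 1" "even (w - 1)" "w - 1 + 3 = w + 2" using False w4 by presburger+
      then show ?thesis using hub_pattern[of "w - 1"] by metis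
    qed
    then have h: "{h, w - 1} \<in> edges ladder" "{w + 2, h} \<in> edges ladder"
      unfolding h_def using spoke0 spoke1 by auto
    have "w - 1 + 1 = w" "w + 1 + 1 = w + 2" using w4 by simp_all
    then have "{w - 1, w} \<in> edges ladder" "{w, w + 1} \<in> edges ladder" "{w + 1, w + 2} \<in> edges ladder"
      using rail[of "w - 1"] rail[of w] rail[of "w + 1"] w4 by simp_all
    moreover have "distinct [h, w - 1, w, w + 1, w + 2]" using w4 by (auto simp: h_def)
    ultimately have "pentagon ladder h (w - 1) w (w + 1) (w + 2)" unfolding pentagon_def using h by simp
    moreover have "ladder_pent w = {h, w - 1, w, w + 1, w + 2}"
      unfolding ladder_pent_def h_def using False by (simp only: if_False)
    ultimately show ?thesis using pentsI by metis
  qed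
qed

text \<open>The vertex 2 tells the two kinds of five-cycles apart. Within one kind w is determined
  by the least path vertex.\<close>

lemma inj_ladder_pent: "inj_on ladder_pent {3..}"
proof (rule inj_onI)
  have two: "2 \<in> ladder_pent w \<longleftrightarrow> w = 3 \<or> 6 \<le> w \<and> even w" if "3 \<le> w" for w
    using that unfolding ladder_pent_def by auto
  have le: "w' \<le> w" if a: "3 \<le> w" "3 \<le> w'" "ladder_pent w = ladder_pent w'" for w w'
  proof (cases "w = 3 \<or> 6 \<le> w \<and> even w")
    case True
    then have "w' = 3 \<or> 6 \<le> w' \<and> even w'" using two[OF a(1)] two[OF a(2)] a(3) by simp
    moreover have "w \<in> ladder_pent w" by (auto simp: ladder_pent_def)
    ultimately have "w \<in> {0, 1, 2, w', w' + 1}" unfolding a(3) by (simp only: ladder_pent_def if_True)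
    then show ?thesis using a(1) by auto
  next
    case False
    then have "\<not> (w' = 3 \<or> 6 \<le> w' \<and> even w')" using two[OF a(1)] two[OF a(2)] a(3) by simp
    then have e: "ladder_pent w' = {if w' - 1 \<in> hub0 then 0 else 1, w' - 1, w', w' + 1, w' + 2}"
      by (simp only: ladder_pent_def if_False)
    have "w - 1 \<in> ladder_pent w" using False by (auto simp: ladder_pent_def)
    then have "w - 1 \<in> {if w' - 1 \<in> hub0 then 0 else 1, w' - 1, w', w' + 1, w' + 2}" unfolding a(3) e .
    then show ?thesis using a(1,2) by (auto split: if_splits)
  qed
  fix w w' assume "w \<in> {3..}" "w' \<in> {3..}" "ladder_pent w = ladder_pent w'"
  then show "w = w'" using le[of w w'] le[of w' w] by simp
qed

section \<open>Counting five-cycles of the ladder\<close>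

lemma card_pents_ladder_ge:
  assumes V: "finite V" and I: "I \<subseteq> {3..}" "\<And>w. w \<in> I \<Longrightarrow> ladder_pent w \<subseteq> V"
  shows "card I \<le> card (pents (induce ladder V))"
proof (rule card_inj_on_le)
  show "inj_on ladder_pent I" using inj_ladder_pent I(1) by (rule inj_on_subset)
  show "ladder_pent ` I \<subseteq> pents (induce ladder V)"
    unfolding pents_induce using ladder_pent_in_pents I by auto
  show "finite (pents (induce ladder V))" using V by (intro finite_pents simple_graph_ladder)
qed

text \<open>For odd n the irregular initial part 3, 4, 5 of the path is left out.\<close>

lemma exists_many_pents:
  assumes n: "4 \<le> n" "n \<noteq> 6"
  obtains V where "finite V" "card V = n" "n - 4 \<le> card (pents (induce ladder V))"
proof (cases "even n")
  case True
  let ?V = "{..<n}" and ?I = "{3..n - 2}"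
  have "ladder_pent w \<subseteq> ?V" if w: "w \<in> ?I" for w
  proof (cases "w = 3 \<or> 6 \<le> w \<and> even w")
    case True then show ?thesis unfolding ladder_pent_def using w n by auto
  next
    case False
    \<comment> \<open>Only w = n - 2 could fail. It is even, hence of the other kind unless it
      equals 4, and this is where n = 6 is excluded.\<close>
    have "w + 2 < n"
    proof (rule ccontr)
      assume "\<not> w + 2 < n"
      then have "w = n - 2" using w by auto
      then show False using False \<open>even n\<close> n w by auto
    qed
    then show ?thesis unfolding ladder_pent_def using False by auto
  qed
  then have "card ?I \<le> card (pents (induce ladder ?V))" by (intro card_pents_ladder_ge) auto
  then show ?thesis using that[of ?V] by simp
next
  case False
  \<comment> \<open>Here the path 6, ..., n + 2 ends at an odd vertex, so the last index n + 1 is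
    even and its five-cycle through the vertex 2 fits. For even n the three additional vertices 3,
    4, 5, which bring three additional five-cycles, correct the parity.\<close>
  let ?V = "{0, 1, 2} \<union> {6..<n + 3}" and ?I = "{6..n + 1}"
  have "ladder_pent w \<subseteq> ?V" if w: "w \<in> ?I" for w
  proof (cases "even w")
    case True then show ?thesis unfolding ladder_pent_def using w by auto
  next
    case odd: False
    then have "7 \<le> w" "w \<le> n" using w False by (auto simp: le_less Suc_le_eq)
    then show ?thesis unfolding ladder_pent_def using odd by auto
  qed
  then have "card ?I \<le> card (pents (induce ladder ?V))" by (intro card_pents_ladder_ge) auto
  moreover have "card ?V = n" using n by (subst card_Un_disjoint) auto
  ultimately show ?thesis using that[of ?V] by simp
qed

theorem theorem2p8:
  fixes n :: nat
  assumes "n \<ge> 4" and "n \<noteq> 6"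
  shows "ex_planar n (cycle_graph 5) {cycle_graph 4} = n - 4"
  unfolding ex_planar_def
proof (rule Max_eqI[OF finite_copy_counts])
  fix k
  assume "k \<in> {card (copies (cycle_graph 5) G) | G. G \<in> planar_free_graphs n {cycle_graph 4}}"
  then obtain G where k: "k = card (copies (cycle_graph 5) G)" and "G \<in> planar_free_graphs n {cycle_graph 4}"
    by blast
  then have G: "simple_graph G" "card (verts G) = n" "planar G" "C4_free G"
    by (auto simp: planar_free_graphs_def free_of_cycle_4)
  then have "card (pents G) + 4 \<le> n" using card_pents_le[of G] assms(1) by simp
  then show "k \<le> n - 4" unfolding k card_copies_cycle_5[OF G(1,4)] by simp
next
  obtain V where V: "finite V" "card V = n" "n - 4 \<le> card (pents (induce ladder V))"
    using exists_many_pents[OF assms] .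
  let ?G = "induce ladder V"
  have G: "simple_graph ?G" "planar ?G" "C4_free ?G" "card (verts ?G) = n"
    using V simple_graph_ladder planar_ladder C4_free_induce[OF C4_free_ladder] by (simp_all add: induce_def)
  then have "?G \<in> planar_free_graphs n {cycle_graph 4}"
    by (simp add: planar_free_graphs_def free_of_cycle_4)
  moreover have "card (pents ?G) = n - 4" using card_pents_le[OF G(1-3)] G(4) V(3) assms(1) by simp
  then have "n - 4 = card (copies (cycle_graph 5) ?G)" using card_copies_cycle_5[OF G(1,3)] by simp
  ultimately show "n - 4 \<in> {card (copies (cycle_graph 5) G) | G. G \<in> planar_free_graphs n {cycle_graph 4}}"
    by blast
qed

end
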